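(* Assume, in the setting described in the context, that $w$ and the $\varepsilon_k$ are Gaussian. Let $\hat w_k^\circ$ be the estimates generated by the optimal updating functions $u_k^\circ(\tilde I_k)=L_k\mathbb{E}\{e_k^\circ|\tilde I_k\}$ of Problem $\mathrm{OLL}_\gamma^N$, and let $\hat w_k^\dagger:=\mathbb{E}\{w|I_k\}$ be the Kalman-filter estimate of $w$ at time $k$. Then $$\hat w_{k+1}^\circ=\hat w_k^\circ+L_k\big(\hat w_k^\circ-\mathbb{E}\{w|I_k\}\big)=\hat w_k^\circ+L_k(\hat w_k^\circ-\hat w_k^\dagger)=\hat w_k^\circ+L_k(e_k^\circ-e_k^\dagger),$$ where $e_k^\circ:=\hat w_k^\circ-w$ and $e_k^\dagger:=\hat w_k^\dagger-w$, and where, for $k=-1,0,\dots$, $$\hat w_{k+1}^\dagger=\hat w_k^\dagger+H_{k+1}(y_{k+1}-C_{k+1}\hat w_k^\dagger),\qquad H_{k+1}:=\Sigma_{k+1}C_{k+1}'(\sigma_\varepsilon^2)^{-1},$$ and, for $k=0,1,\dots$, $$\Sigma_k=\Sigma_{k-1}-\Sigma_{k-1}C_k'(C_k\Sigma_{k-1}C_k'+\sigma_\varepsilon^2)^{-1}C_k\Sigma_{k-1},$$ with the initializations $\hat w_{-1}^\dagger=0$, $\hat w_{-1}^\circ=0$, and $L_{-1}=-(\overline K_0+\gamma I)^{-1}\overline K_0$.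
   Context: A prime denotes transpose, $I$ is the $d\times d$ identity matrix, $N\ge 1$ is an integer and $\gamma>0$. Data model: $w\in\mathbb{R}^d$ is a random vector, $x_k\in\mathbb{R}^d$ and $\varepsilon_k\in\mathbb{R}$ ($k=0,1,\dots$) are random inputs and noises; the random variables $w,\{x_k\},\{\varepsilon_k\}$ are mutually independent and have mean $0$; $w$ has covariance matrix $\Sigma_w$, the $\varepsilon_k$ have the same variance $\sigma_\varepsilon^2>0$, and each $x_k$ has finite covariance matrix $\mathbb{E}\{x_kx_k'\}$. The outputs are $y_k=w'x_k+\varepsilon_k$. Put $C_k:=x_k'$ and $Q_k:=x_kx_k'$. Learning machine: $\hat w_0:=0$, $\hat w_{k+1}=\hat w_k+u_k$, where the update $u_k\in\mathbb{R}^d$ is a function $u_k(I_k)$ of the information vector $I_k:=\{(x_j,y_j),\ j=0,\dots,k;\ u_j,\ j=0,\dots,k-1\}$ ($I_0:=\{(x_0,y_0)\}$; $I_{-1}$ is empty, so that $\mathbb{E}\{w|I_{-1}\}=\mathbb{E}\{w\}=0$). Error: $e_k:=\hat w_k-w$, so $e_0=-w$, $e_{k+1}=e_k+u_k$. Put $\tilde y_k:=\hat w_k'x_k-y_k$ and $\tilde I_k:=\{(x_j,\tilde y_j),\ j=0,\dots,k;\ u_j,\ j=0,\dots,k-1\}$; $I_k$ and $\tilde I_k$ are in one-to-one correspondence. Problem $\mathrm{OLL}_\gamma^N$: find updating functions $u_0^\circ,\dots,u_{N-1}^\circ$ minimizing $\mathbb{E}\{\sum_{k=0}^{N-1}[e_k'Q_ke_k+\gamma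 u_k'u_k]+e_N'Q_Ne_N\}$. Its optimal updating functions are $u_k^\circ(\tilde I_k)=L_k\mathbb{E}\{e_k^\circ|\tilde I_k\}$, $k=0,\dots,N-1$, with $L_k:=-(\overline K_{k+1}+\gamma I)^{-1}\overline K_{k+1}$, $\overline K_N=\mathbb{E}\{Q_N\}$, $\overline K_k=\overline K_{k+1}-\overline K_{k+1}(\overline K_{k+1}+\gamma I)^{-1}\overline K_{k+1}+\mathbb{E}\{Q_k\}$. The superscript $\circ$ denotes quantities evaluated when these updating functions are applied; the recursion for $\hat w_{k+1}^\circ$ is for $k=-1,0,\dots,N-1$. Covariances: $\Sigma_k:=\mathbb{E}\{(e_k-\mathbb{E}\{e_k|\tilde I_k\})(e_k-\mathbb{E}\{e_k|\tilde I_k\})'\,|\,\tilde I_k\}$ for $k\ge 0$, and $\Sigma_{-1}:=\Sigma_w$. *)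

theory Defs
  imports "HOL-Probability.Probability"
begin

text \<open>
  Time is indexed by \<open>int\<close> because several of the sequences start at \<open>-1\<close>. The data \<open>x\<close>,
  \<open>eps\<close>, \<open>y\<close> and the updates \<open>u\<close> are meaningful for indices \<open>\<ge> 0\<close> only; their values at
  negative indices are never used.
\<close>

datatype source = Weight | Input int | Noise int

text \<open>The set systems below are those of \<open>indep_vars2_def\<close>; \<open>indep_vars\<close> itself cannot
  mix vector-valued and real-valued variables.\<close>

definition mutually_independent ::
  "'a measure \<Rightarrow> ('a \<Rightarrow> real^'d) \<Rightarrow> (int \<Rightarrow> 'a \<Rightarrow> real^'d) \<Rightarrow> (int \<Rightarrow> 'a \<Rightarrow> real) \<Rightarrow> bool" where
  "mutually_independent M w x eps \<longleftrightarrow>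
     w \<in> borel_measurable M \<and>
     (\<forall>k\<ge>0. x k \<in> borel_measurable M) \<and>
     (\<forall>k\<ge>0. eps k \<in> borel_measurable M) \<and>
     prob_space.indep_sets M
       (\<lambda>s. case s of
            Weight \<Rightarrow> {w -` A \<inter> space M | A. A \<in> sets borel}
          | Input k \<Rightarrow> {x k -` A \<inter> space M | A. A \<in> sets borel}
          | Noise k \<Rightarrow> {eps k -` A \<inter> space M | A. A \<in> sets borel})
       ({Weight} \<union> Input ` {0..} \<union> Noise ` {0..})"

definition zero_mean :: "'a measure \<Rightarrow> ('a \<Rightarrow> 'b::euclidean_space) \<Rightarrow> bool" where
  "zero_mean M X \<longleftrightarrow> integrable M X \<and> integral\<^sup>L M X = 0"

definition outer :: "real^'m \<Rightarrow> real^'n \<Rightarrow> real^'n^'m" where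
  "outer a b = (\<chi> i j. a $ i * b $ j)"

definition has_covariance :: "'a measure \<Rightarrow> ('a \<Rightarrow> real^'d) \<Rightarrow> real^'d^'d \<Rightarrow> bool" where
  "has_covariance M X V \<longleftrightarrow>
     integrable M (\<lambda>\<omega>. outer (X \<omega> - integral\<^sup>L M X) (X \<omega> - integral\<^sup>L M X)) \<and>
     (\<integral>\<omega>. outer (X \<omega> - integral\<^sup>L M X) (X \<omega> - integral\<^sup>L M X) \<partial>M) = V"

text \<open>Possibly degenerate Gaussian variables: every linear functional is univariate normal or
  almost surely constant.\<close>

definition gaussian :: "'a measure \<Rightarrow> ('a \<Rightarrow> 'b::euclidean_space) \<Rightarrow> bool" where
  "gaussian M X \<longleftrightarrow>
     X \<in> borel_measurable M \<and>
     (\<forall>a. \<exists>m s. 0 < s \<and> distributed M lborel (\<lambda>\<omega>. a \<bullet> X \<omega>) (normal_density m s)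
              \<or> (AE \<omega> in M. a \<bullet> X \<omega> = m))"

text \<open>Coordinatewise extension of \<open>real_cond_exp\<close>; used for both vectors and matrices.\<close>

definition cond_exp ::
  "'a measure \<Rightarrow> 'a measure \<Rightarrow> ('a \<Rightarrow> 'b::euclidean_space) \<Rightarrow> 'a \<Rightarrow> 'b" where
  "cond_exp M F X \<omega> = (\<Sum>b\<in>Basis. real_cond_exp M F (\<lambda>\<omega>'. X \<omega>' \<bullet> b) \<omega> *\<^sub>R b)"

definition cond_cov ::
  "'a measure \<Rightarrow> 'a measure \<Rightarrow> ('a \<Rightarrow> real^'d) \<Rightarrow> 'a \<Rightarrow> real^'d^'d" where
  "cond_cov M F X =
     cond_exp M F (\<lambda>\<omega>. outer (X \<omega> - cond_exp M F X \<omega>) (X \<omega> - cond_exp M F X \<omega>))"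

text \<open>The information vector at time \<open>k\<close> as a random element. For \<open>k = -1\<close> both index sets are
  empty and the vector carries no information.\<close>

type_synonym 'd info = "(int \<Rightarrow> (real^'d) \<times> real) \<times> (int \<Rightarrow> real^'d)"

definition info ::
  "(int \<Rightarrow> 'a \<Rightarrow> real^'d) \<Rightarrow> (int \<Rightarrow> 'a \<Rightarrow> real) \<Rightarrow> (int \<Rightarrow> 'a \<Rightarrow> real^'d) \<Rightarrow> int \<Rightarrow> 'a \<Rightarrow> 'd info" where
  "info x y u k \<omega> = ((\<lambda>j\<in>{0..k}. (x j \<omega>, y j \<omega>)), (\<lambda>j\<in>{0..<k}. u j \<omega>))"

definition info_space :: "int \<Rightarrow> ('d::finite) info measure" where
  "info_space k = (\<Pi>\<^sub>M j\<in>{0..k}. borel \<Otimes>\<^sub>M borel) \<Otimes>\<^sub>M (\<Pi>\<^sub>M j\<in>{0..<k}. borel)"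

definition info_algebra ::
  "'a measure \<Rightarrow> (int \<Rightarrow> 'a \<Rightarrow> real^'d) \<Rightarrow> (int \<Rightarrow> 'a \<Rightarrow> real) \<Rightarrow> (int \<Rightarrow> 'a \<Rightarrow> real^'d) \<Rightarrow> int \<Rightarrow> 'a measure" where
  "info_algebra M x y u k = vimage_algebra (space M) (info x y u k) (info_space k)"

text \<open>Backward Riccati recursion with terminal value \<open>Q N\<close> at \<open>k = N\<close>.\<close>

function riccati :: "real \<Rightarrow> int \<Rightarrow> (int \<Rightarrow> real^'d^'d) \<Rightarrow> int \<Rightarrow> real^'d^'d" where
  "riccati g N Q k =
     (if k \<ge> N then Q N
      else riccati g N Q (k + 1)
           - riccati g N Q (k + 1) ** matrix_inv (riccati g N Q (k + 1) + g *\<^sub>R mat 1)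
               ** riccati g N Q (k + 1)
           + Q k)"
  by pat_completeness auto
termination
  by (relation "Wellfounded.measure (\<lambda>(g, N, Q, k). nat (N - k))") auto

declare riccati.simps [simp del]

definition gain :: "real \<Rightarrow> int \<Rightarrow> (int \<Rightarrow> real^'d^'d) \<Rightarrow> int \<Rightarrow> real^'d^'d" where
  "gain g N Q k = - (matrix_inv (riccati g N Q (k + 1) + g *\<^sub>R mat 1) ** riccati g N Q (k + 1))"

end

theory Submission
  imports Defs
begin

text \<open>
  Freeze the inputs at deterministic values \<open>z\<close>. Then \<open>w\<close> minus the Kalman estimate is a centered
  Gaussian linear form in \<open>w\<close> and the noises, its covariance matrix is given by the Riccati recursion,
  and it is uncorrelated with the outputs; uncorrelated jointly Gaussian forms \<open>U\<close>, \<open>W\<close> satisfy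
  \<open>E (h U * exp (\<i> W)) = E (h U) * E (exp (\<i> W))\<close>. Integrating over the inputs, which are independent
  of \<open>w\<close> and the noises, shows that \<open>err\<close> and \<open>err err' - cov\<close> are orthogonal to every
  \<open>1\<^sub>a exp (\<i> \<Sum>\<^sub>j t\<^sub>j y\<^sub>j)\<close> with \<open>a\<close> an event of the inputs, hence by Fourier uniqueness to every
  event of the inputs and outputs. This identifies the conditional mean and covariance given the
  information vector. The updates are functions of past data, so they add no information, and
  \<open>E (e | I) = w_opt - E (w | I)\<close> turns the optimal update into the stated recursion.
\<close>

subsection \<open>Fourier uniqueness\<close>

text \<open>The outputs contain the products \<open>w \<omega> \<bullet> x k \<omega>\<close> and
  the Kalman gains depend on the inputs, so for random inputs \<open>w\<close> and the outputs are
  in general not jointly Gaussian. Given the inputs they are, which is why the Gaussian computation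
  has to precede the integration over the inputs. Characteristic functions carry this computation
  rather than densities, because the covariance of \<open>w\<close> may be singular. Orthogonality
  is proved on an algebra with the events of all inputs, later ones included. It is larger than the
  information algebra, which is harmless: the filter mean and the filter covariance are already
  measurable for the smaller one. The test functions \<open>h\<close> in use are the identity and a
  shifted square. Both are unbounded, so uniqueness is stated for integrable products instead of
  bounded \<open>h\<close>. Vectors and matrices enter through the functionals
  \<open>c \<bullet> _\<close>; mixed entries of covariances come from squares by
  polarization.\<close>

lemma integrable_mult_iexp:
  fixes f :: "'a \<Rightarrow> complex"
  assumes "integrable M f" and [measurable]: "Y \<in> borel_measurable M"
  shows "integrable M (\<lambda>\<omega>. f \<omega> * iexp (Y \<omega>))"
proof -
  have [measurable]: "f \<in> borel_measurable M" using assms(1) by simp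
  show ?thesis by (rule Bochner_Integration.integrable_bound[OF assms(1)]) (auto simp: norm_mult)
qed

text \<open>A signed density has no characteristic function in the sense of probability laws, so
  \<open>f\<close> is split into positive and negative part. The hypothesis at \<open>t = 0\<close>
  gives both the same mass \<open>c\<close>. If \<open>c\<close> is positive, division by
  \<open>c\<close> yields two probability laws of \<open>U\<close> with equal characteristic
  functions, and \<open>Levy_uniqueness\<close> identifies them.\<close>

lemma fourier_zero_real:
  fixes f U :: "'a \<Rightarrow> real" and h :: "real \<Rightarrow> real"
  assumes f: "integrable M f" and U[measurable]: "U \<in> borel_measurable M"
    and zero: "\<And>t. (\<integral>\<omega>. complex_of_real (f \<omega>) * iexp (t * U \<omega>) \<partial>M) = 0"
    and h[measurable]: "h \<in> borel_measurable borel"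
    and fh: "integrable M (\<lambda>\<omega>. f \<omega> * h (U \<omega>))"
  shows "(\<integral>\<omega>. f \<omega> * h (U \<omega>) \<partial>M) = 0"
proof -
  have fm[measurable]: "f \<in> borel_measurable M" using f by simp
  define p where "p = (\<lambda>\<omega>. max 0 (f \<omega>))"
  define n where "n = (\<lambda>\<omega>. max 0 (- f \<omega>))"
  have pm[measurable]: "p \<in> borel_measurable M" "n \<in> borel_measurable M"
    unfolding p_def n_def by auto
  have nonneg: "0 \<le> p \<omega>" "0 \<le> n \<omega>" for \<omega> by (auto simp: p_def n_def)
  have f_eq: "f \<omega> = p \<omega> - n \<omega>" for \<omega> by (auto simp: p_def n_def max_def)
  have int_p: "integrable M p" "integrable M n"
    unfolding p_def n_def using f by auto
  have int_iexp: "integrable M (\<lambda>\<omega>. complex_of_real (g \<omega>) * iexp (t * U \<omega>))"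
    if "integrable M g" for g :: "'a \<Rightarrow> real" and t
    by (intro integrable_mult_iexp) (use that in auto)
  have eq_iexp: "(\<integral>\<omega>. complex_of_real (p \<omega>) * iexp (t * U \<omega>) \<partial>M)
      = (\<integral>\<omega>. complex_of_real (n \<omega>) * iexp (t * U \<omega>) \<partial>M)" for t
  proof -
    have "(\<integral>\<omega>. complex_of_real (f \<omega>) * iexp (t * U \<omega>) \<partial>M)
      = (\<integral>\<omega>. complex_of_real (p \<omega>) * iexp (t * U \<omega>) - complex_of_real (n \<omega>) * iexp (t * U \<omega>) \<partial>M)"
      by (simp add: f_eq algebra_simps)
    also have "\<dots> = (\<integral>\<omega>. complex_of_real (p \<omega>) * iexp (t * U \<omega>) \<partial>M)
      - (\<integral>\<omega>. complex_of_real (n \<omega>) * iexp (t * U \<omega>) \<partial>M)"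
      by (intro Bochner_Integration.integral_diff int_iexp int_p)
    finally show ?thesis using zero[of t] by simp
  qed
  define c where "c = integral\<^sup>L M p"
  have c_n: "integral\<^sup>L M n = c"
    using eq_iexp[of 0] by (simp add: c_def)
  have c_nonneg: "0 \<le> c" unfolding c_def using nonneg by (intro integral_nonneg_AE) auto
  show ?thesis
  proof (cases "c = 0")
    case True
    have "AE \<omega> in M. p \<omega> = 0"
      using integral_nonneg_eq_0_iff_AE[OF int_p(1)] nonneg True c_def by auto
    moreover have "AE \<omega> in M. n \<omega> = 0"
      using integral_nonneg_eq_0_iff_AE[OF int_p(2)] nonneg True c_n by auto
    ultimately have "AE \<omega> in M. f \<omega> * h (U \<omega>) = 0"
      by eventually_elim (simp add: f_eq)
    then show ?thesis by (simp add: integral_eq_zero_AE)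
  next
    case False
    then have c: "0 < c" using c_nonneg by simp
    \<comment> \<open>The law of \<open>U\<close> under the probability with density
      \<open>g / c\<close>; it is formed for \<open>g = p\<close> and for
      \<open>g = n\<close>.\<close>
    define D where "D = (\<lambda>g :: 'a \<Rightarrow> real. distr (density M (\<lambda>\<omega>. ennreal (g \<omega> / c))) borel U)"
    have D: "real_distribution (D g)" "char (D g) t = (\<integral>\<omega>. complex_of_real (g \<omega>) * iexp (t * U \<omega>) \<partial>M) / c"
      "(\<integral>r. h r \<partial>(D g)) = (\<integral>\<omega>. g \<omega> * h (U \<omega>) \<partial>M) / c"
      if g: "integrable M g" "\<And>\<omega>. 0 \<le> g \<omega>" "integral\<^sup>L M g = c" for g t
    proof -
      have [measurable]: "g \<in> borel_measurable M" using g by simp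
      have "emeasure (density M (\<lambda>\<omega>. ennreal (g \<omega> / c))) (space M) = (\<integral>\<^sup>+ \<omega>. ennreal (g \<omega> / c) \<partial>M)"
        by (subst emeasure_density) (auto intro!: nn_integral_cong)
      also have "\<dots> = ennreal (\<integral>\<omega>. g \<omega> / c \<partial>M)"
        using g c by (intro nn_integral_eq_integral) auto
      also have "\<dots> = 1" using g c by simp
      finally have "prob_space (density M (\<lambda>\<omega>. ennreal (g \<omega> / c)))"
        by (intro prob_spaceI) simp
      then interpret d: prob_space "density M (\<lambda>\<omega>. ennreal (g \<omega> / c))" .
      show "real_distribution (D g)" unfolding D_def
        by (intro d.real_distribution_distr) simp
      have "char (D g) t = (\<integral>\<omega>. (g \<omega> / c) *\<^sub>R iexp (t * U \<omega>) \<partial>M)"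
        unfolding char_def D_def using g c
        by (subst integral_distr, simp, simp, subst integral_density) auto
      also have "\<dots> = (\<integral>\<omega>. (complex_of_real (g \<omega>) * iexp (t * U \<omega>)) / c \<partial>M)"
        by (simp add: scaleR_conv_of_real)
      also have "\<dots> = (\<integral>\<omega>. (complex_of_real (g \<omega>) * iexp (t * U \<omega>)) \<partial>M) / c" by simp
      finally show "char (D g) t = (\<integral>\<omega>. complex_of_real (g \<omega>) * iexp (t * U \<omega>) \<partial>M) / c" .
      have "(\<integral>r. h r \<partial>(D g)) = (\<integral>\<omega>. (g \<omega> / c) *\<^sub>R h (U \<omega>) \<partial>M)"
        unfolding D_def using g c
        by (subst integral_distr, simp, simp, subst integral_density) auto
      also have "\<dots> = (\<integral>\<omega>. (g \<omega> * h (U \<omega>)) / c \<partial>M)" by simp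
      also have "\<dots> = (\<integral>\<omega>. g \<omega> * h (U \<omega>) \<partial>M) / c" by (rule integral_divide_zero)
      finally show "(\<integral>r. h r \<partial>(D g)) = (\<integral>\<omega>. g \<omega> * h (U \<omega>) \<partial>M) / c" .
    qed
    have "char (D p) = char (D n)"
    proof
      fix t
      show "char (D p) t = char (D n) t"
        using D(2)[OF int_p(1) nonneg(1) c_def[symmetric], of t] D(2)[OF int_p(2) nonneg(2) c_n, of t]
          eq_iexp[of t] by (simp only:)
    qed
    then have "D p = D n"
      by (intro Levy_uniqueness D(1) int_p nonneg c_n c_def[symmetric])
    then have "(\<integral>\<omega>. p \<omega> * h (U \<omega>) \<partial>M) = (\<integral>\<omega>. n \<omega> * h (U \<omega>) \<partial>M)"
      using D(3)[OF int_p(1)] D(3)[OF int_p(2)] nonneg c c_n c_def by simp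
    moreover have "integrable M (\<lambda>\<omega>. p \<omega> * h (U \<omega>))" "integrable M (\<lambda>\<omega>. n \<omega> * h (U \<omega>))"
      by (rule Bochner_Integration.integrable_bound[OF fh]; auto simp: p_def n_def abs_mult intro!: mult_right_mono)+
    ultimately show ?thesis
      by (simp add: f_eq left_diff_distrib)
  qed
qed

text \<open>The transform of the conjugate of \<open>f\<close> at \<open>t\<close> is the conjugate
  of the transform of \<open>f\<close> at \<open>- t\<close>, so it vanishes as well. Real and
  imaginary part are combinations of \<open>f\<close> and its conjugate, and the real case applies
  to each. Complex \<open>f\<close> are wanted because exponential factors will be absorbed into
  \<open>f\<close>.\<close>

lemma fourier_zero:
  fixes f :: "'a \<Rightarrow> complex" and U :: "'a \<Rightarrow> real" and h :: "real \<Rightarrow> real"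
  assumes f: "integrable M f" and U[measurable]: "U \<in> borel_measurable M"
    and zero: "\<And>t. (\<integral>\<omega>. f \<omega> * iexp (t * U \<omega>) \<partial>M) = 0"
    and h[measurable]: "h \<in> borel_measurable borel"
    and fh: "integrable M (\<lambda>\<omega>. f \<omega> * complex_of_real (h (U \<omega>)))"
  shows "(\<integral>\<omega>. f \<omega> * complex_of_real (h (U \<omega>)) \<partial>M) = 0"
proof -
  have fm[measurable]: "f \<in> borel_measurable M" using f by simp
  have int: "integrable M (\<lambda>\<omega>. f \<omega> * iexp (t * U \<omega>))" for t
    by (intro integrable_mult_iexp f) simp
  have zero': "(\<integral>\<omega>. cnj (f \<omega>) * iexp (t * U \<omega>) \<partial>M) = 0" for t
  proof -
    have "(\<integral>\<omega>. cnj (f \<omega>) * iexp (t * U \<omega>) \<partial>M) = (\<integral>\<omega>. cnj (f \<omega> * iexp ((- t) * U \<omega>)) \<partial>M)"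
      by (simp add: exp_cnj)
    also have "\<dots> = cnj (\<integral>\<omega>. f \<omega> * iexp ((- t) * U \<omega>) \<partial>M)"
      by (simp del: complex_cnj_mult)
    finally show ?thesis using zero[of "- t"] by simp
  qed
  have int': "integrable M (\<lambda>\<omega>. cnj (f \<omega>) * iexp (t * U \<omega>))" for t
    by (intro integrable_mult_iexp) (use f in auto)
  have re: "complex_of_real (Re z) = (z + cnj z) / 2" for z by (simp add: complex_eq_iff)
  have im: "complex_of_real (Im z) = (z - cnj z) / (2 * \<i>)" for z
    by (simp add: complex_eq_iff Re_divide Im_divide power2_eq_square)
  have "(\<integral>\<omega>. Re (f \<omega>) * h (U \<omega>) \<partial>M) = 0"
  proof (rule fourier_zero_real[where U = U and h = h])
    show "(\<integral>\<omega>. complex_of_real (Re (f \<omega>)) * iexp (t * U \<omega>) \<partial>M) = 0" for t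
      by (simp only: re times_divide_eq_left distrib_right integral_divide_zero Bochner_Integration.integral_add[OF int int']
          zero zero' add_0 diff_0_right div_0)
    show "integrable M (\<lambda>\<omega>. Re (f \<omega>) * h (U \<omega>))" using integrable_Re[OF fh] by simp
  qed (use f in auto)
  moreover have "(\<integral>\<omega>. Im (f \<omega>) * h (U \<omega>) \<partial>M) = 0"
  proof (rule fourier_zero_real[where U = U and h = h])
    show "(\<integral>\<omega>. complex_of_real (Im (f \<omega>)) * iexp (t * U \<omega>) \<partial>M) = 0" for t
      by (simp only: im times_divide_eq_left left_diff_distrib integral_divide_zero Bochner_Integration.integral_diff[OF int int']
          zero zero' add_0 diff_0_right div_0)
    show "integrable M (\<lambda>\<omega>. Im (f \<omega>) * h (U \<omega>))" using integrable_Im[OF fh] by simp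
  qed (use f in auto)
  ultimately show ?thesis
    using integral_Re[OF fh] integral_Im[OF fh] by (simp add: complex_eq_iff)
qed

text \<open>Exponentials are traded for indicators one coordinate at a time. With the other
  exponentials absorbed into the function, \<open>fourier_zero\<close> handles the last coordinate;
  the resulting indicator is absorbed into \<open>f\<close> for the induction hypothesis. Thus
  one-dimensional uniqueness gives the multivariate one.\<close>

lemma fourier_zero_rectangle:
  fixes f :: "'a \<Rightarrow> complex" and Y :: "nat \<Rightarrow> 'a \<Rightarrow> real"
  assumes "integrable M f" and "\<And>j. j < n \<Longrightarrow> Y j \<in> borel_measurable M"
    and "\<And>t. (\<integral>\<omega>. f \<omega> * iexp (\<Sum>j<n. t j * Y j \<omega>) \<partial>M) = 0"
    and "\<And>j. j < n \<Longrightarrow> B j \<in> sets borel"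
  shows "(\<integral>\<omega>. f \<omega> * complex_of_real (\<Prod>j<n. indicator (B j) (Y j \<omega>)) \<partial>M) = 0"
  using assms
proof (induction n arbitrary: f)
  case 0
  then show ?case by simp
next
  case (Suc n)
  note [measurable] = Suc.prems(2)[of n, simplified] Suc.prems(4)[of n, simplified]
  have Ym[measurable]: "Y j \<in> borel_measurable M" if "j < n" for j using Suc.prems(2) that by simp
  have fm[measurable]: "f \<in> borel_measurable M" using Suc.prems(1) by simp
  define f' where "f' = (\<lambda>\<omega>. f \<omega> * complex_of_real (indicator (B n) (Y n \<omega>)))"
  have f': "integrable M f'"
    by (rule Bochner_Integration.integrable_bound[OF Suc.prems(1)])
      (auto simp: f'_def norm_mult split: split_indicator)
  have "(\<integral>\<omega>. f' \<omega> * iexp (\<Sum>j<n. t j * Y j \<omega>) \<partial>M) = 0" for t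
  proof -
    define g where "g = (\<lambda>\<omega>. f \<omega> * iexp (\<Sum>j<n. t j * Y j \<omega>))"
    have g: "integrable M g"
      unfolding g_def by (intro integrable_mult_iexp Suc.prems(1)) simp
    have [measurable]: "g \<in> borel_measurable M" using g by simp
    have "(\<integral>\<omega>. g \<omega> * complex_of_real (indicator (B n) (Y n \<omega>)) \<partial>M) = 0"
    proof (rule fourier_zero[OF g, where U = "Y n" and h = "indicator (B n)"])
      fix s
      \<comment> \<open>The frequencies of the first \<open>n\<close> coordinates stay fixed in
        \<open>g\<close>; moving \<open>s\<close> means using the hypothesis at
        \<open>t(n := s)\<close>.\<close>
      have "g \<omega> * iexp (s * Y n \<omega>) = f \<omega> * iexp (\<Sum>j<Suc n. (t(n := s)) j * Y j \<omega>)" for \<omega>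
        by (simp add: g_def algebra_simps exp_add)
      then show "(\<integral>\<omega>. g \<omega> * iexp (s * Y n \<omega>) \<partial>M) = 0"
        using Suc.prems(3)[of "t(n := s)"] by simp
      show "integrable M (\<lambda>\<omega>. g \<omega> * complex_of_real (indicator (B n) (Y n \<omega>)))"
        by (rule Bochner_Integration.integrable_bound[OF g])
          (auto simp: norm_mult split: split_indicator)
    qed auto
    then show ?thesis by (simp add: g_def f'_def mult_ac)
  qed
  with Suc.IH[OF f'] Suc.prems show ?case
    by (simp add: f'_def mult_ac)
qed

section \<open>The sigma-algebra of the inputs and the first outputs\<close>

text \<open>Rectangles are chosen as generators because they are stable under intersection and are
  the sets that the Fourier argument reaches. In the application \<open>A\<close> contains the
  events of the inputs at all times, so one algebra \<open>A\<close> serves every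
  \<open>n\<close>.\<close>

definition joint_algebra :: "'a measure \<Rightarrow> 'a measure \<Rightarrow> (nat \<Rightarrow> 'a \<Rightarrow> real) \<Rightarrow> nat \<Rightarrow> 'a measure" where
  "joint_algebra M A Y n = sigma (space M)
     {a \<inter> {\<omega>\<in>space M. \<forall>j<n. Y j \<omega> \<in> B j} |a B. a \<in> sets A \<and> (\<forall>j<n. B j \<in> sets borel)}"

lemma space_joint_algebra [simp]: "space (joint_algebra M A Y n) = space M"
  unfolding joint_algebra_def by (rule space_measure_of) auto

lemma sets_joint_algebra:
  "sets (joint_algebra M A Y n) = sigma_sets (space M)
     {a \<inter> {\<omega>\<in>space M. \<forall>j<n. Y j \<omega> \<in> B j} |a B. a \<in> sets A \<and> (\<forall>j<n. B j \<in> sets borel)}"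
  unfolding joint_algebra_def by (rule sets_measure_of) auto

lemma measurable_joint_algebra:
  assumes "subalgebra M A" and "f \<in> measurable A N"
  shows "f \<in> measurable (joint_algebra M A Y n) N"
proof (rule measurableI)
  fix B assume "B \<in> sets N"
  then have "f -` B \<inter> space M \<in> sets A"
    using measurable_sets[OF assms(2)] assms(1) by (auto simp: subalgebra_def)
  moreover have "f -` B \<inter> space M = (f -` B \<inter> space M) \<inter> {\<omega>\<in>space M. \<forall>j<n. Y j \<omega> \<in> UNIV}" by auto
  ultimately show "f -` B \<inter> space (joint_algebra M A Y n) \<in> sets (joint_algebra M A Y n)"
    unfolding sets_joint_algebra space_joint_algebra
    by (intro sigma_sets.Basic CollectI exI[of _ "f -` B \<inter> space M"] exI[of _ "\<lambda>_. UNIV"]) auto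
qed (use assms measurable_space[OF assms(2)] in \<open>auto simp: subalgebra_def\<close>)

lemma measurable_joint_algebra_observation:
  assumes "subalgebra M A" and "i < n"
  shows "Y i \<in> borel_measurable (joint_algebra M A Y n)"
proof (rule measurableI)
  fix B :: "real set" assume B: "B \<in> sets borel"
  \<comment> \<open>Only coordinate \<open>i\<close> is constrained, so the box condition is that of
    \<open>Y i\<close> alone.\<close>
  define B' where "B' = (\<lambda>j. if j = i then B else UNIV)"
  have "\<forall>j<n. B' j \<in> sets borel" using B by (simp add: B'_def)
  moreover have "space M \<in> sets A" using assms(1) sets.top[of A] by (simp add: subalgebra_def)
  moreover have "(\<forall>j<n. Y j \<omega> \<in> B' j) \<longleftrightarrow> Y i \<omega> \<in> B" for \<omega>
  proof (intro iffI allI impI)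
    assume "\<forall>j<n. Y j \<omega> \<in> B' j"
    then have "Y i \<omega> \<in> B' i" using assms(2) by blast
    then show "Y i \<omega> \<in> B" by (simp add: B'_def)
  next
    fix j assume "Y i \<omega> \<in> B"
    then show "Y j \<omega> \<in> B' j" by (cases "j = i") (simp_all add: B'_def)
  qed
  then have "Y i -` B \<inter> space M = space M \<inter> {\<omega>\<in>space M. \<forall>j<n. Y j \<omega> \<in> B' j}" by blast
  ultimately show "Y i -` B \<inter> space (joint_algebra M A Y n) \<in> sets (joint_algebra M A Y n)"
    unfolding sets_joint_algebra space_joint_algebra
    by (intro sigma_sets.Basic CollectI exI[of _ "space M"] exI[of _ B'] conjI)
qed simp

text \<open>Rectangles are settled by \<open>fourier_zero_rectangle\<close> for
  \<open>indicator a \<omega> * f \<omega>\<close>, and the sets with vanishing integral form a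
  Dynkin system. Membership in \<open>sets M\<close> is part of the conclusion so that the induction
  itself delivers the measurability used for complements and unions.\<close>

lemma joint_algebra_integral_zero:
  fixes f :: "'a \<Rightarrow> real"
  assumes A: "subalgebra M A" and f: "integrable M f"
    and Y: "\<And>j. j < n \<Longrightarrow> Y j \<in> borel_measurable M"
    and zero: "\<And>a t. a \<in> sets A \<Longrightarrow>
      (\<integral>\<omega>. complex_of_real (indicator a \<omega> * f \<omega>) * iexp (\<Sum>j<n. t j * Y j \<omega>) \<partial>M) = 0"
    and G: "G \<in> sets (joint_algebra M A Y n)"
  shows "G \<in> sets M \<and> (\<integral>\<omega>. indicator G \<omega> * f \<omega> \<partial>M) = 0"
proof -
  let ?E = "{a \<inter> {\<omega>\<in>space M. \<forall>j<n. Y j \<omega> \<in> B j} |a B. a \<in> sets A \<and> (\<forall>j<n. B j \<in> sets borel)}"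
  have fm[measurable]: "f \<in> borel_measurable M" using f by simp
  have spA: "space M \<in> sets A" using A sets.top[of A] by (auto simp: subalgebra_def)
  have int: "integrable M (\<lambda>\<omega>. indicator G \<omega> * f \<omega>)" if "G \<in> sets M" for G
    using integrable_mult_indicator[OF that f] by simp
  have gen: "G \<in> sets M \<and> (\<integral>\<omega>. indicator G \<omega> * f \<omega> \<partial>M) = 0" if "G \<in> ?E" for G
  proof -
    from that obtain a B where aB: "a \<in> sets A" "\<And>j. j < n \<Longrightarrow> B j \<in> sets borel"
      "G = a \<inter> {\<omega>\<in>space M. \<forall>j<n. Y j \<omega> \<in> B j}" by auto
    have a: "a \<in> sets M" using aB(1) A by (auto simp: subalgebra_def)
    have "{\<omega>\<in>space M. Y j \<omega> \<in> B j} \<in> sets M" if "j < n" for j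
      using measurable_sets[OF Y aB(2), OF that that] by (simp add: vimage_def Int_def conj_commute)
    then have "{\<omega>\<in>space M. \<forall>j\<in>{..<n}. Y j \<omega> \<in> B j} \<in> sets M"
      by (intro sets.sets_Collect_finite_All) auto
    then have "{\<omega>\<in>space M. \<forall>j<n. Y j \<omega> \<in> B j} \<in> sets M"
      by (simp only: Ball_def lessThan_iff)
    then have "G \<in> sets M" unfolding aB(3) by (intro sets.Int a)
    have ind: "indicator G \<omega> = indicator a \<omega> * (\<Prod>j<n. indicator (B j) (Y j \<omega>) :: real)"
      if "\<omega> \<in> space M" for \<omega>
    proof (cases "\<forall>j<n. Y j \<omega> \<in> B j")
      case True
      then show ?thesis using that by (auto simp: aB(3) indicator_def)
    next
      case False
      then have "(\<Prod>j<n. indicator (B j) (Y j \<omega>) :: real) = 0"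
        by (intro prod_zero) (auto simp: indicator_def)
      then show ?thesis using False by (auto simp: aB(3))
    qed
    have "integrable M (\<lambda>\<omega>. complex_of_real (indicator a \<omega> * f \<omega>))"
      by (intro integrable_of_real int a)
    then have "(\<integral>\<omega>. complex_of_real (indicator a \<omega> * f \<omega>) * complex_of_real (\<Prod>j<n. indicator (B j) (Y j \<omega>)) \<partial>M) = 0"
      by (rule fourier_zero_rectangle[OF _ Y zero[OF aB(1)] aB(2)])
    then have "(\<integral>\<omega>. indicator a \<omega> * f \<omega> * (\<Prod>j<n. indicator (B j) (Y j \<omega>)) \<partial>M) = 0"
      by (simp only: flip: of_real_mult) (simp only: integral_complex_of_real of_real_eq_0_iff)
    moreover have "(\<integral>\<omega>. indicator G \<omega> * f \<omega> \<partial>M)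
        = (\<integral>\<omega>. indicator a \<omega> * f \<omega> * (\<Prod>j<n. indicator (B j) (Y j \<omega>)) \<partial>M)"
      by (rule Bochner_Integration.integral_cong) (simp_all only: ind mult_ac)
    ultimately have "(\<integral>\<omega>. indicator G \<omega> * f \<omega> \<partial>M) = 0" by simp
    with \<open>G \<in> sets M\<close> show ?thesis by simp
  qed
  have stable: "Int_stable ?E"
  proof (rule Int_stableI)
    fix G G' assume "G \<in> ?E" "G' \<in> ?E"
    then obtain a B a' B' where *: "a \<in> sets A" "\<forall>j<n. B j \<in> sets borel"
      "G = a \<inter> {\<omega>\<in>space M. \<forall>j<n. Y j \<omega> \<in> B j}" "a' \<in> sets A" "\<forall>j<n. B' j \<in> sets borel"
      "G' = a' \<inter> {\<omega>\<in>space M. \<forall>j<n. Y j \<omega> \<in> B' j}" by blast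
    then have "G \<inter> G' = (a \<inter> a') \<inter> {\<omega>\<in>space M. \<forall>j<n. Y j \<omega> \<in> B j \<inter> B' j}" by auto
    with * show "G \<inter> G' \<in> ?E"
      by (intro CollectI exI[of _ "a \<inter> a'"] exI[of _ "\<lambda>j. B j \<inter> B' j"]) auto
  qed
  have top: "space M \<in> ?E"
    by (intro CollectI exI[of _ "space M"] exI[of _ "\<lambda>_. UNIV"]) (use spA in auto)
  have "?E \<subseteq> Pow (space M)" by auto
  from stable this G[unfolded sets_joint_algebra]
  show ?thesis
  proof (induction rule: sigma_sets_induct_disjoint)
    case (basic G)
    then show ?case by (rule gen)
  next
    case empty
    show ?case by simp
  next
    case (compl G)
    have "(\<integral>\<omega>. indicator (space M - G) \<omega> * f \<omega> \<partial>M)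
        = (\<integral>\<omega>. indicator (space M) \<omega> * f \<omega> - indicator G \<omega> * f \<omega> \<partial>M)"
      by (intro Bochner_Integration.integral_cong) (auto split: split_indicator)
    also have "\<dots> = (\<integral>\<omega>. indicator (space M) \<omega> * f \<omega> \<partial>M) - (\<integral>\<omega>. indicator G \<omega> * f \<omega> \<partial>M)"
      using compl by (intro Bochner_Integration.integral_diff int) auto
    \<comment> \<open>The whole space is itself a rectangle, hence the total integral of
      \<open>f\<close> vanishes.\<close>
    also have "\<dots> = 0"
      using conjunct2[OF gen[OF top]] conjunct2[OF compl(2)] by (simp only: diff_self)
    finally show ?case using compl by (intro conjI sets.compl_sets) auto
  next
    case (union F)
    have F: "F i \<in> sets M" for i using union by auto
    have "(\<integral>\<omega>\<in>(\<Union>i. F i). f \<omega> \<partial>M) = (\<Sum>i. \<integral>\<omega>\<in>F i. f \<omega> \<partial>M)"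
      using union(1) F int[of "\<Union>i. F i"]
      by (intro lebesgue_integral_countable_add)
        (auto simp: disjoint_family_on_def set_integrable_def)
    also have "\<dots> = 0"
      using union by (simp add: set_lebesgue_integral_def)
    finally show ?case using F by (auto simp: set_lebesgue_integral_def)
  qed
qed

section \<open>Uncorrelated jointly Gaussian variables\<close>

text \<open>In use \<open>p\<close> and \<open>q\<close> are the variances of \<open>U\<close> and
  \<open>V\<close>, and the missing mixed term in the exponent says that the two are uncorrelated.
  Then \<open>iexp (V \<omega>) - exp (- q / 2)\<close> has vanishing transform against
  \<open>U\<close>, and \<open>fourier_zero\<close> replaces the exponentials in \<open>U\<close> by
  \<open>h (U \<omega>)\<close>. Variance zero is covered.\<close>

lemma gaussian_pair:
  fixes U V :: "'a \<Rightarrow> real" and h :: "real \<Rightarrow> real"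
  assumes "prob_space M"
    and U[measurable]: "U \<in> borel_measurable M" and V[measurable]: "V \<in> borel_measurable M"
    and char: "\<And>s. (\<integral>\<omega>. iexp (s * U \<omega> + V \<omega>) \<partial>M) = exp (- (s\<^sup>2 * p + q) / 2)"
      "\<And>s. (\<integral>\<omega>. iexp (s * U \<omega>) \<partial>M) = exp (- (s\<^sup>2 * p) / 2)"
    and h[measurable]: "h \<in> borel_measurable borel" and hU: "integrable M (\<lambda>\<omega>. h (U \<omega>))"
  shows "(\<integral>\<omega>. complex_of_real (h (U \<omega>)) * iexp (V \<omega>) \<partial>M) = exp (- q / 2) * (\<integral>\<omega>. h (U \<omega>) \<partial>M)"
proof -
  interpret prob_space M by fact
  have i1: "integrable M (\<lambda>\<omega>. iexp (V \<omega>))" "integrable M (\<lambda>\<omega>. iexp (s * U \<omega>))"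
    "integrable M (\<lambda>\<omega>. iexp (s * U \<omega> + V \<omega>))" for s
    by (rule integrable_const_bound[where B = 1]; auto)+
  have i2: "integrable M (\<lambda>\<omega>. complex_of_real (h (U \<omega>)) * iexp (V \<omega>))"
    by (intro integrable_mult_iexp) (use hU in auto)
  have i3: "integrable M (\<lambda>\<omega>. complex_of_real (h (U \<omega>)))" using hU by auto
  have "(\<integral>\<omega>. (iexp (V \<omega>) - complex_of_real (exp (- q / 2))) * complex_of_real (h (U \<omega>)) \<partial>M) = 0"
  proof (rule fourier_zero[where U = U and h = h])
    fix s
    have "(iexp (V \<omega>) - complex_of_real (exp (- q / 2))) * iexp (s * U \<omega>)
      = iexp (s * U \<omega> + V \<omega>) - complex_of_real (exp (- q / 2)) * iexp (s * U \<omega>)" for \<omega>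
      by (simp add: algebra_simps exp_add)
    then have "(\<integral>\<omega>. (iexp (V \<omega>) - complex_of_real (exp (- q / 2))) * iexp (s * U \<omega>) \<partial>M)
      = (\<integral>\<omega>. iexp (s * U \<omega> + V \<omega>) \<partial>M) - complex_of_real (exp (- q / 2)) * (\<integral>\<omega>. iexp (s * U \<omega>) \<partial>M)"
      using i1 by simp
    also have "\<dots> = 0"
      unfolding char by (simp flip: of_real_mult exp_add add: field_simps add_divide_distrib)
    finally show "(\<integral>\<omega>. (iexp (V \<omega>) - complex_of_real (exp (- q / 2))) * iexp (s * U \<omega>) \<partial>M) = 0" .
    show "integrable M (\<lambda>\<omega>. (iexp (V \<omega>) - complex_of_real (exp (- q / 2))) * complex_of_real (h (U \<omega>)))"
      using i2 i3 unfolding left_diff_distrib by (intro Bochner_Integration.integrable_diff) (auto simp: mult.commute)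
  qed (use i1 in auto)
  also have "(\<lambda>\<omega>. (iexp (V \<omega>) - complex_of_real (exp (- q / 2))) * complex_of_real (h (U \<omega>)))
    = (\<lambda>\<omega>. complex_of_real (h (U \<omega>)) * iexp (V \<omega>) - complex_of_real (exp (- q / 2)) * complex_of_real (h (U \<omega>)))"
    by (auto simp: algebra_simps)
  finally show ?thesis using i2 i3 by simp
qed

subsection \<open>Kalman recursion and freezing of independent arguments\<close>

text \<open>The last argument counts processed observations, so the value at \<open>n\<close>
  belongs to time \<open>n - 1\<close> of the model and the value at \<open>0\<close> is the prior.
  For a symmetric matrix the rank-one correction is the matrix Riccati step, see
  \<open>riccati_step\<close>.\<close>

primrec kalman_cov :: "real^'d^'d \<Rightarrow> real \<Rightarrow> (nat \<Rightarrow> real^'d) \<Rightarrow> nat \<Rightarrow> real^'d^'d" where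
  "kalman_cov V r z 0 = V"
| "kalman_cov V r z (Suc n) = kalman_cov V r z n
     - inverse (z n \<bullet> (kalman_cov V r z n *v z n) + r)
         *\<^sub>R outer (kalman_cov V r z n *v z n) (kalman_cov V r z n *v z n)"

text \<open>The gain uses the covariance before the update. In this form the new error is the old
  one minus a multiple of the innovation, which suits the induction in \<open>err_filter\<close>;
  the form with the updated covariance is recovered in \<open>filter_mean_Suc\<close>.\<close>

primrec kalman_mean ::
  "real^'d^'d \<Rightarrow> real \<Rightarrow> (nat \<Rightarrow> real^'d) \<Rightarrow> (nat \<Rightarrow> real) \<Rightarrow> nat \<Rightarrow> real^'d" where
  "kalman_mean V r z y 0 = 0"
| "kalman_mean V r z y (Suc n) = kalman_mean V r z y n
     + ((y n - z n \<bullet> kalman_mean V r z y n) / (z n \<bullet> (kalman_cov V r z n *v z n) + r))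
         *\<^sub>R (kalman_cov V r z n *v z n)"

lemma outer_mult_vec: "outer a b *v d = (b \<bullet> d) *\<^sub>R a"
  by (simp add: vec_eq_iff outer_def matrix_vector_mult_def inner_vec_def sum_distrib_left mult_ac)

lemma borel_measurable_matrix_vector_mult [measurable (raw)]:
  fixes f :: "'a \<Rightarrow> real^'n^'m" and g :: "'a \<Rightarrow> real^'n"
  assumes "f \<in> borel_measurable N" "g \<in> borel_measurable N"
  shows "(\<lambda>\<omega>. f \<omega> *v g \<omega>) \<in> borel_measurable N"
  using assms
  by (rule borel_measurable_continuous_Pair)
    (unfold matrix_vector_mult_def, intro continuous_intros)

lemma borel_measurable_outer [measurable (raw)]:
  fixes f :: "'a \<Rightarrow> real^'m" and g :: "'a \<Rightarrow> real^'n"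
  assumes "f \<in> borel_measurable N" "g \<in> borel_measurable N"
  shows "(\<lambda>\<omega>. outer (f \<omega>) (g \<omega>)) \<in> borel_measurable N"
  using assms
  by (rule borel_measurable_continuous_Pair)
    (unfold outer_def, intro continuous_intros)

lemma measurable_kalman_cov:
  assumes "\<And>j. j < n \<Longrightarrow> z j \<in> borel_measurable N"
  shows "(\<lambda>\<omega>. kalman_cov V r (\<lambda>j. z j \<omega>) n) \<in> borel_measurable N"
  using assms
proof (induction n)
  case (Suc n)
  have [measurable]: "z n \<in> borel_measurable N" using Suc.prems by simp
  have [measurable]: "(\<lambda>\<omega>. kalman_cov V r (\<lambda>j. z j \<omega>) n) \<in> borel_measurable N"
    using Suc by simp
  show ?case by simp
qed simp

lemma measurable_kalman_mean:
  assumes "\<And>j. j < n \<Longrightarrow> z j \<in> borel_measurable N"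
    and "\<And>j. j < n \<Longrightarrow> y j \<in> borel_measurable N"
  shows "(\<lambda>\<omega>. kalman_mean V r (\<lambda>j. z j \<omega>) (\<lambda>j. y j \<omega>) n) \<in> borel_measurable N"
  using assms
proof (induction n)
  case (Suc n)
  have [measurable]: "z n \<in> borel_measurable N" "y n \<in> borel_measurable N" using Suc.prems by simp_all
  have [measurable]: "(\<lambda>\<omega>. kalman_cov V r (\<lambda>j. z j \<omega>) n) \<in> borel_measurable N"
    using Suc by (intro measurable_kalman_cov) simp
  have [measurable]: "(\<lambda>\<omega>. kalman_mean V r (\<lambda>j. z j \<omega>) (\<lambda>j. y j \<omega>) n) \<in> borel_measurable N"
    using Suc by simp
  show ?case by simp
qed simp

section \<open>Square-integrable functions\<close>

lemma integrable_mult_of_squares: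
  fixes f g :: "'a \<Rightarrow> real"
  assumes [measurable]: "f \<in> borel_measurable M" "g \<in> borel_measurable M"
    and "integrable M (\<lambda>\<omega>. (f \<omega>)\<^sup>2)" "integrable M (\<lambda>\<omega>. (g \<omega>)\<^sup>2)"
  shows "integrable M (\<lambda>\<omega>. f \<omega> * g \<omega>)"
proof (rule Bochner_Integration.integrable_bound)
  show "integrable M (\<lambda>\<omega>. (f \<omega>)\<^sup>2 + (g \<omega>)\<^sup>2)" using assms by simp
  have "\<bar>a * b\<bar> \<le> a\<^sup>2 + b\<^sup>2" for a b :: real
  proof -
    have "2 * (\<bar>a\<bar> * \<bar>b\<bar>) \<le> a\<^sup>2 + b\<^sup>2" "0 \<le> \<bar>a\<bar> * \<bar>b\<bar>"
      using sum_squares_bound[of "\<bar>a\<bar>" "\<bar>b\<bar>"] by (simp_all add: mult.assoc)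
    then show ?thesis unfolding abs_mult by linarith
  qed
  then show "AE \<omega> in M. norm (f \<omega> * g \<omega>) \<le> norm ((f \<omega>)\<^sup>2 + (g \<omega>)\<^sup>2)" by simp
qed simp

lemma integrable_square_add:
  fixes f g :: "'a \<Rightarrow> real"
  assumes "f \<in> borel_measurable M" "g \<in> borel_measurable M"
    and "integrable M (\<lambda>\<omega>. (f \<omega>)\<^sup>2)" "integrable M (\<lambda>\<omega>. (g \<omega>)\<^sup>2)"
  shows "integrable M (\<lambda>\<omega>. (f \<omega> + g \<omega>)\<^sup>2)"
  using integrable_mult_of_squares[OF assms] assms(3,4)
  by (simp add: power2_sum mult.assoc)

context prob_space
begin

lemma integrable_of_square:
  fixes f :: "'a \<Rightarrow> real"
  assumes [measurable]: "f \<in> borel_measurable M" and "integrable M (\<lambda>\<omega>. (f \<omega>)\<^sup>2)"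
  shows "integrable M f"
  using integrable_mult_of_squares[of f M "\<lambda>_. 1"] assms by simp

text \<open>For independent \<open>\<sigma>\<close>-algebras the diagonal map is distributed like a product, so that
  functions of both can be integrated with the first argument frozen.\<close>

lemma restr_to_subalg_pair_eq_distr:
  assumes A: "subalgebra M A" and B: "subalgebra M B"
    and indep: "\<And>a b. a \<in> sets A \<Longrightarrow> b \<in> sets B \<Longrightarrow> prob (a \<inter> b) = prob a * prob b"
  shows "restr_to_subalg M A \<Otimes>\<^sub>M restr_to_subalg M B = distr M (A \<Otimes>\<^sub>M B) (\<lambda>\<omega>. (\<omega>, \<omega>))"
proof (rule pair_measure_eqI)
  interpret a: prob_space "restr_to_subalg M A" using A by (rule prob_space_restr_to_subalg) unfold_locales
  interpret b: prob_space "restr_to_subalg M B" using B by (rule prob_space_restr_to_subalg) unfold_locales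
  show "sigma_finite_measure (restr_to_subalg M A)" "sigma_finite_measure (restr_to_subalg M B)"
    by unfold_locales
  show "sets (restr_to_subalg M A \<Otimes>\<^sub>M restr_to_subalg M B) = sets (distr M (A \<Otimes>\<^sub>M B) (\<lambda>\<omega>. (\<omega>, \<omega>)))"
    by (simp add: sets_restr_to_subalg A B cong: sets_pair_measure_cong)
  have diag: "(\<lambda>\<omega>. (\<omega>, \<omega>)) \<in> measurable M (A \<Otimes>\<^sub>M B)"
    by (intro measurable_Pair measurable_from_subalg[OF A] measurable_from_subalg[OF B]) simp_all
  fix a b assume "a \<in> sets (restr_to_subalg M A)" "b \<in> sets (restr_to_subalg M B)"
  then have ab: "a \<in> sets A" "b \<in> sets B" by (simp_all add: sets_restr_to_subalg A B)
  then have "a \<in> sets M" "b \<in> sets M" using A B by (auto simp: subalgebra_def)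
  have "emeasure (distr M (A \<Otimes>\<^sub>M B) (\<lambda>\<omega>. (\<omega>, \<omega>))) (a \<times> b) = emeasure M ((\<lambda>\<omega>. (\<omega>, \<omega>)) -` (a \<times> b) \<inter> space M)"
    using ab by (intro emeasure_distr diag) auto
  also have "(\<lambda>\<omega>. (\<omega>, \<omega>)) -` (a \<times> b) \<inter> space M = a \<inter> b"
    using sets.sets_into_space[OF \<open>a \<in> sets M\<close>] by auto
  also have "emeasure M (a \<inter> b) = emeasure M a * emeasure M b"
    by (simp add: emeasure_eq_measure indep[OF ab] ennreal_mult)
  finally show "emeasure (restr_to_subalg M A) a * emeasure (restr_to_subalg M B) b
      = emeasure (distr M (A \<Otimes>\<^sub>M B) (\<lambda>\<omega>. (\<omega>, \<omega>))) (a \<times> b)"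
    using ab by (simp add: emeasure_restr_to_subalg A B)
qed

text \<open>\<open>(\<omega>, \<omega>)\<close> is distributed like the product of the restrictions
  of \<open>M\<close> to \<open>A\<close> and to \<open>B\<close>, so Tonelli and Fubini integrate a
  diagonal function in two stages; sections are \<open>B\<close>-measurable, so their integrals may
  be taken over \<open>M\<close> again. The nonnegative version serves for moment bounds, the
  version with vanishing inner integrals for orthogonality.\<close>

lemma freeze:
  assumes A: "subalgebra M A" and B: "subalgebra M B"
    and indep: "\<And>a b. a \<in> sets A \<Longrightarrow> b \<in> sets B \<Longrightarrow> prob (a \<inter> b) = prob a * prob b"
  shows nn_integral_freeze: "\<And>F. F \<in> borel_measurable (A \<Otimes>\<^sub>M B) \<Longrightarrow>
      (\<integral>\<^sup>+\<omega>. F (\<omega>, \<omega>) \<partial>M) = (\<integral>\<^sup>+\<omega>. (\<integral>\<^sup>+\<omega>'. F (\<omega>, \<omega>') \<partial>M) \<partial>M)"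
    and integral_freeze_zero: "\<And>F :: 'a \<times> 'a \<Rightarrow> complex. F \<in> borel_measurable (A \<Otimes>\<^sub>M B) \<Longrightarrow>
      integrable M (\<lambda>\<omega>. F (\<omega>, \<omega>)) \<Longrightarrow> (\<And>\<omega>. \<omega> \<in> space M \<Longrightarrow> (\<integral>\<omega>'. F (\<omega>, \<omega>') \<partial>M) = 0) \<Longrightarrow>
      (\<integral>\<omega>. F (\<omega>, \<omega>) \<partial>M) = 0"
proof -
  interpret a: prob_space "restr_to_subalg M A" using A by (rule prob_space_restr_to_subalg) unfold_locales
  interpret b: prob_space "restr_to_subalg M B" using B by (rule prob_space_restr_to_subalg) unfold_locales
  interpret ab: pair_sigma_finite "restr_to_subalg M A" "restr_to_subalg M B" ..
  have eq: "restr_to_subalg M A \<Otimes>\<^sub>M restr_to_subalg M B = distr M (A \<Otimes>\<^sub>M B) (\<lambda>\<omega>. (\<omega>, \<omega>))"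
    using A B indep by (rule restr_to_subalg_pair_eq_distr)
  have [measurable]: "(\<lambda>\<omega>. (\<omega>, \<omega>)) \<in> measurable M (A \<Otimes>\<^sub>M B)"
    by (intro measurable_Pair measurable_from_subalg[OF A] measurable_from_subalg[OF B]) simp_all
  have sets_eq: "sets (restr_to_subalg M A \<Otimes>\<^sub>M restr_to_subalg M B) = sets (A \<Otimes>\<^sub>M B)"
    by (simp add: sets_restr_to_subalg A B cong: sets_pair_measure_cong)
  {
    fix F :: "'a \<times> 'a \<Rightarrow> ennreal" assume F[measurable]: "F \<in> borel_measurable (A \<Otimes>\<^sub>M B)"
    have F': "F \<in> borel_measurable (restr_to_subalg M A \<Otimes>\<^sub>M restr_to_subalg M B)"
      using F measurable_cong_sets[OF sets_eq refl] by blast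
    have inner: "(\<lambda>\<omega>'. F (\<omega>, \<omega>')) \<in> borel_measurable B" if "\<omega> \<in> space M" for \<omega>
      using that A by (intro measurable_compose[OF measurable_Pair1' F]) (simp add: subalgebra_def)
    have "(\<integral>\<^sup>+\<omega>. F (\<omega>, \<omega>) \<partial>M) = (\<integral>\<^sup>+p. F p \<partial>distr M (A \<Otimes>\<^sub>M B) (\<lambda>\<omega>. (\<omega>, \<omega>)))"
      by (simp add: nn_integral_distr)
    also have "\<dots> = (\<integral>\<^sup>+\<omega>. (\<integral>\<^sup>+\<omega>'. F (\<omega>, \<omega>') \<partial>restr_to_subalg M B) \<partial>restr_to_subalg M A)"
      unfolding eq[symmetric] by (rule b.nn_integral_fst[symmetric]) (rule F')
    also have "\<dots> = (\<integral>\<^sup>+\<omega>. (\<integral>\<^sup>+\<omega>'. F (\<omega>, \<omega>') \<partial>M) \<partial>restr_to_subalg M A)"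
      by (intro nn_integral_cong nn_integral_subalgebra2[OF B] inner) (simp add: space_restr_to_subalg)
    also have "\<dots> = (\<integral>\<^sup>+\<omega>. (\<integral>\<^sup>+\<omega>'. F (\<omega>, \<omega>') \<partial>M) \<partial>M)"
    proof (rule nn_integral_subalgebra2[OF A])
      have "(\<lambda>\<omega>. \<integral>\<^sup>+\<omega>'. F (\<omega>, \<omega>') \<partial>restr_to_subalg M B) \<in> borel_measurable (restr_to_subalg M A)"
        by (rule b.borel_measurable_nn_integral_fst) (rule F')
      then have "(\<lambda>\<omega>. \<integral>\<^sup>+\<omega>'. F (\<omega>, \<omega>') \<partial>M) \<in> borel_measurable (restr_to_subalg M A)"
        by (rule measurable_cong[THEN iffD1, rotated])
          (intro nn_integral_subalgebra2[OF B] inner, simp add: space_restr_to_subalg)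
      then show "(\<lambda>\<omega>. \<integral>\<^sup>+\<omega>'. F (\<omega>, \<omega>') \<partial>M) \<in> borel_measurable A"
        by (rule measurable_in_subalg'[OF A])
    qed
    finally show "(\<integral>\<^sup>+\<omega>. F (\<omega>, \<omega>) \<partial>M) = (\<integral>\<^sup>+\<omega>. (\<integral>\<^sup>+\<omega>'. F (\<omega>, \<omega>') \<partial>M) \<partial>M)" .
  }
  {
    fix F :: "'a \<times> 'a \<Rightarrow> complex" assume F[measurable]: "F \<in> borel_measurable (A \<Otimes>\<^sub>M B)"
      and int: "integrable M (\<lambda>\<omega>. F (\<omega>, \<omega>))"
      and zero: "\<And>\<omega>. \<omega> \<in> space M \<Longrightarrow> (\<integral>\<omega>'. F (\<omega>, \<omega>') \<partial>M) = 0"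
    have inner: "(\<lambda>\<omega>'. F (\<omega>, \<omega>')) \<in> borel_measurable B" if "\<omega> \<in> space M" for \<omega>
      using that A by (intro measurable_compose[OF measurable_Pair1' F]) (simp add: subalgebra_def)
    have "(\<integral>\<omega>. F (\<omega>, \<omega>) \<partial>M) = (\<integral>p. F p \<partial>distr M (A \<Otimes>\<^sub>M B) (\<lambda>\<omega>. (\<omega>, \<omega>)))"
      by (simp add: integral_distr)
    also have "\<dots> = (\<integral>\<omega>. (\<integral>\<omega>'. F (\<omega>, \<omega>') \<partial>restr_to_subalg M B) \<partial>restr_to_subalg M A)"
      unfolding eq[symmetric]
      by (rule ab.integral_fst'[symmetric]) (simp add: eq integrable_distr_eq int)
    also have "\<dots> = (\<integral>\<omega>. 0 \<partial>restr_to_subalg M A)"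
      by (intro Bochner_Integration.integral_cong refl)
        (simp add: space_restr_to_subalg integral_subalgebra2[OF B inner] zero)
    finally show "(\<integral>\<omega>. F (\<omega>, \<omega>) \<partial>M) = 0" by simp
  }
qed

end

subsection \<open>The filter for frozen inputs\<close>

text \<open>\<open>A\<close> carries the inputs, \<open>B\<close> the weight and the noises. Second
  moments are stated through linear functionals of \<open>w\<close>, which reduces the filter
  computation to real integrals. \<open>char_linear\<close> expresses joint Gaussianity of weight
  and noises at frequency one; scaling the coefficients gives every other frequency.\<close>

locale linear_gaussian = prob_space M for M :: "'a measure" +
  fixes A B :: "'a measure" and w :: "'a \<Rightarrow> real^'d" and X :: "nat \<Rightarrow> 'a \<Rightarrow> real^'d"
    and eps :: "nat \<Rightarrow> 'a \<Rightarrow> real" and V :: "real^'d^'d" and r :: real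
  assumes subalg_A: "subalgebra M A" and subalg_B: "subalgebra M B"
    and indep_AB: "\<And>a b. a \<in> sets A \<Longrightarrow> b \<in> sets B \<Longrightarrow> prob (a \<inter> b) = prob a * prob b"
    and X_meas: "\<And>j. X j \<in> borel_measurable A"
    and w_meas: "w \<in> borel_measurable B"
    and eps_meas: "\<And>j. eps j \<in> borel_measurable B"
    and r_pos: "0 < r"
    and w_square: "\<And>c. integrable M (\<lambda>\<omega>. (c \<bullet> w \<omega>)\<^sup>2)"
    and eps_square: "\<And>j. integrable M (\<lambda>\<omega>. (eps j \<omega>)\<^sup>2)"
    and w_mean: "\<And>c. (\<integral>\<omega>. c \<bullet> w \<omega> \<partial>M) = 0"
    and eps_mean: "\<And>j. (\<integral>\<omega>. eps j \<omega> \<partial>M) = 0"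
    and w_cov: "\<And>c d. (\<integral>\<omega>. (c \<bullet> w \<omega>) * (d \<bullet> w \<omega>) \<partial>M) = c \<bullet> (V *v d)"
    and eps_var: "\<And>j. (\<integral>\<omega>. (eps j \<omega>)\<^sup>2 \<partial>M) = r"
    and w_eps: "\<And>c j. (\<integral>\<omega>. (c \<bullet> w \<omega>) * eps j \<omega> \<partial>M) = 0"
    and eps_eps: "\<And>i j. i \<noteq> j \<Longrightarrow> (\<integral>\<omega>. eps i \<omega> * eps j \<omega> \<partial>M) = 0"
    and char_linear: "\<And>c b n. (\<integral>\<omega>. iexp (c \<bullet> w \<omega> + (\<Sum>j<n. b j * eps j \<omega>)) \<partial>M)
      = exp (- (\<integral>\<omega>. (c \<bullet> w \<omega> + (\<Sum>j<n. b j * eps j \<omega>))\<^sup>2 \<partial>M) / 2)"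
begin

section \<open>Linear forms in the weight and the first noises\<close>

text \<open>A vector space of centered square-integrable Gaussian variables in which the filter
  lives once the inputs are fixed. It stops before \<open>eps n\<close>, so that the next noise is
  orthogonal to it.\<close>

definition forms :: "nat \<Rightarrow> ('a \<Rightarrow> real) set" where
  "forms n = {\<lambda>\<omega>. c \<bullet> w \<omega> + (\<Sum>j<n. b j * eps j \<omega>) |c b. True}"

lemma forms_w: "(\<lambda>\<omega>. c \<bullet> w \<omega>) \<in> forms n"
  unfolding forms_def by (intro CollectI exI[of _ c] exI[of _ "\<lambda>_. 0"]) simp

lemma forms_zero: "(\<lambda>\<omega>. 0) \<in> forms n"
  using forms_w[of 0] by simp

lemma forms_add:
  assumes "f \<in> forms n" "g \<in> forms n" shows "(\<lambda>\<omega>. f \<omega> + g \<omega>) \<in> forms n"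
proof -
  obtain c b c' b' where "f = (\<lambda>\<omega>. c \<bullet> w \<omega> + (\<Sum>j<n. b j * eps j \<omega>))"
    "g = (\<lambda>\<omega>. c' \<bullet> w \<omega> + (\<Sum>j<n. b' j * eps j \<omega>))" using assms unfolding forms_def by auto
  then show ?thesis unfolding forms_def
    by (intro CollectI exI[of _ "c + c'"] exI[of _ "\<lambda>j. b j + b' j"])
      (simp add: inner_add_left distrib_right sum.distrib add_ac)
qed

lemma forms_scale:
  assumes "f \<in> forms n" shows "(\<lambda>\<omega>. s * f \<omega>) \<in> forms n"
proof -
  obtain c b where "f = (\<lambda>\<omega>. c \<bullet> w \<omega> + (\<Sum>j<n. b j * eps j \<omega>))" using assms unfolding forms_def by auto
  then show ?thesis unfolding forms_def
    by (intro CollectI exI[of _ "s *\<^sub>R c"] exI[of _ "\<lambda>j. s * b j"])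
      (simp add: distrib_left sum_distrib_left mult_ac)
qed

lemma forms_diff:
  assumes "f \<in> forms n" "g \<in> forms n" shows "(\<lambda>\<omega>. f \<omega> - g \<omega>) \<in> forms n"
  using forms_add[OF assms(1) forms_scale[OF assms(2), of "- 1"]] by simp

lemma forms_sum:
  assumes "\<And>j. j \<in> J \<Longrightarrow> f j \<in> forms n" shows "(\<lambda>\<omega>. \<Sum>j\<in>J. f j \<omega>) \<in> forms n"
  using assms
proof (induction J rule: infinite_finite_induct)
  case (insert i J)
  then have "(\<lambda>\<omega>. f i \<omega> + (\<Sum>j\<in>J. f j \<omega>)) \<in> forms n"
    by (intro forms_add) simp_all
  with insert show ?case by simp
qed (simp_all add: forms_zero)

lemma forms_Suc:
  assumes "f \<in> forms n" shows "f \<in> forms (Suc n)"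
proof -
  obtain c b where f: "f = (\<lambda>\<omega>. c \<bullet> w \<omega> + (\<Sum>j<n. b j * eps j \<omega>))" using assms unfolding forms_def by auto
  have "f = (\<lambda>\<omega>. c \<bullet> w \<omega> + (\<Sum>j<Suc n. (b(n := 0)) j * eps j \<omega>))" by (simp add: f)
  then show ?thesis unfolding forms_def by blast
qed

lemma forms_mono: "m \<le> n \<Longrightarrow> f \<in> forms m \<Longrightarrow> f \<in> forms n"
  by (induction n rule: dec_induct) (simp_all add: forms_Suc)

lemma forms_eps: "j < n \<Longrightarrow> eps j \<in> forms n"
proof (rule forms_mono)
  show "eps j \<in> forms (Suc j)" unfolding forms_def
    by (intro CollectI exI[of _ 0] exI[of _ "\<lambda>i. if i = j then 1 else 0"]) auto
qed simp

lemma eps_meas_M [measurable]: "eps j \<in> borel_measurable M"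
  by (rule measurable_from_subalg[OF subalg_B eps_meas])

lemma w_meas_M [measurable]: "w \<in> borel_measurable M"
  by (rule measurable_from_subalg[OF subalg_B w_meas])

lemma X_meas_M [measurable]: "X j \<in> borel_measurable M"
  by (rule measurable_from_subalg[OF subalg_A X_meas])

lemma forms_measurable: "f \<in> forms n \<Longrightarrow> f \<in> borel_measurable M"
  unfolding forms_def by auto

lemma forms_square: assumes "f \<in> forms n" shows "integrable M (\<lambda>\<omega>. (f \<omega>)\<^sup>2)"
proof -
  have "integrable M (\<lambda>\<omega>. (c \<bullet> w \<omega> + (\<Sum>j<n. b j * eps j \<omega>))\<^sup>2)" for c b
  proof (induction n)
    case (Suc n)
    have "integrable M (\<lambda>\<omega>. (b n * eps n \<omega>)\<^sup>2)"
      by (simp add: power_mult_distrib eps_square)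
    then have "integrable M (\<lambda>\<omega>. ((c \<bullet> w \<omega> + (\<Sum>j<n. b j * eps j \<omega>)) + b n * eps n \<omega>)\<^sup>2)"
      by (intro integrable_square_add[OF _ _ Suc]) simp_all
    then show ?case by (simp add: add.assoc)
  qed (simp add: w_square)
  then show ?thesis using assms unfolding forms_def by auto
qed

lemma forms_integrable: "f \<in> forms n \<Longrightarrow> integrable M f"
  by (rule integrable_of_square[OF forms_measurable forms_square])

lemma forms_mult: "f \<in> forms n \<Longrightarrow> g \<in> forms n \<Longrightarrow> integrable M (\<lambda>\<omega>. f \<omega> * g \<omega>)"
  by (rule integrable_mult_of_squares[OF forms_measurable forms_measurable forms_square forms_square])

lemma forms_mean: assumes "f \<in> forms n" shows "(\<integral>\<omega>. f \<omega> \<partial>M) = 0"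
proof -
  have "integrable M (\<lambda>\<omega>. c \<bullet> w \<omega>)" "integrable M (eps j)" for c j
    using forms_integrable[OF forms_w] forms_integrable[OF forms_eps[of j "Suc j"]] by auto
  then show ?thesis using assms unfolding forms_def by (auto simp: w_mean eps_mean)
qed

lemma forms_char:
  assumes "f \<in> forms n"
  shows "(\<integral>\<omega>. iexp (f \<omega>) \<partial>M) = exp (- (\<integral>\<omega>. (f \<omega>)\<^sup>2 \<partial>M) / 2)"
proof -
  obtain c b where f: "f = (\<lambda>\<omega>. c \<bullet> w \<omega> + (\<Sum>j<n. b j * eps j \<omega>))" using assms unfolding forms_def by auto
  show ?thesis unfolding f by (rule char_linear)
qed

lemma forms_orth: assumes "f \<in> forms n" shows "(\<integral>\<omega>. f \<omega> * eps n \<omega> \<partial>M) = 0"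
proof -
  obtain c b where f: "f = (\<lambda>\<omega>. c \<bullet> w \<omega> + (\<Sum>j<n. b j * eps j \<omega>))" using assms unfolding forms_def by auto
  have "integrable M (\<lambda>\<omega>. (c \<bullet> w \<omega>) * eps n \<omega>)" "j < n \<Longrightarrow> integrable M (\<lambda>\<omega>. eps j \<omega> * eps n \<omega>)" for j
    using forms_mult[OF forms_w forms_eps[of n "Suc n"]] forms_mult[OF forms_eps[of j "Suc n"] forms_eps[of n "Suc n"]] by auto
  then have "(\<integral>\<omega>. (c \<bullet> w \<omega>) * eps n \<omega> + (\<Sum>j<n. b j * (eps j \<omega> * eps n \<omega>)) \<partial>M)
    = (\<integral>\<omega>. (c \<bullet> w \<omega>) * eps n \<omega> \<partial>M) + (\<Sum>j<n. b j * (\<integral>\<omega>. eps j \<omega> * eps n \<omega> \<partial>M))"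
    by (subst Bochner_Integration.integral_add) auto
  also have "\<dots> = 0" by (simp add: w_eps eps_eps)
  finally show ?thesis unfolding f
    by (simp only: distrib_right sum_distrib_right mult.assoc)
qed

lemma forms_orth': "f \<in> forms n \<Longrightarrow> (\<integral>\<omega>. eps n \<omega> * f \<omega> \<partial>M) = 0"
  using forms_orth[of f n] by (simp only: mult.commute)

text \<open>Combinations of forms are forms, so \<open>forms_char\<close> supplies the joint
  characteristic function; orthogonality removes the mixed term
  \<open>2 * s * (U \<omega> * W \<omega>)\<close> from its exponent, as
  \<open>gaussian_pair\<close> requires.\<close>

lemma forms_pair:
  assumes U: "U \<in> forms n" and W: "W \<in> forms n" and orth: "(\<integral>\<omega>. U \<omega> * W \<omega> \<partial>M) = 0"
    and h: "h \<in> borel_measurable borel" and hU: "integrable M (\<lambda>\<omega>. h (U \<omega>))"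
  shows "(\<integral>\<omega>. complex_of_real (h (U \<omega>)) * iexp (W \<omega>) \<partial>M)
    = exp (- (\<integral>\<omega>. (W \<omega>)\<^sup>2 \<partial>M) / 2) * (\<integral>\<omega>. h (U \<omega>) \<partial>M)"
proof (rule gaussian_pair[OF prob_space_axioms _ _ _ _ h hU])
  show "U \<in> borel_measurable M" "W \<in> borel_measurable M" using U W forms_measurable by auto
  fix s
  note ints = forms_square[OF U] forms_square[OF W] forms_mult[OF U W]
  have sU: "(\<lambda>\<omega>. s * U \<omega>) \<in> forms n" by (rule forms_scale[OF U])
  have "(\<integral>\<omega>. (s * U \<omega>)\<^sup>2 \<partial>M) = s\<^sup>2 * (\<integral>\<omega>. (U \<omega>)\<^sup>2 \<partial>M)"
    by (simp add: power_mult_distrib)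
  then show "(\<integral>\<omega>. iexp (s * U \<omega>) \<partial>M) = exp (- (s\<^sup>2 * (\<integral>\<omega>. (U \<omega>)\<^sup>2 \<partial>M)) / 2)"
    using forms_char[OF sU] by (simp only:)
  have "(\<integral>\<omega>. (s * U \<omega> + W \<omega>)\<^sup>2 \<partial>M) = (\<integral>\<omega>. s\<^sup>2 * (U \<omega>)\<^sup>2 + (W \<omega>)\<^sup>2 + 2 * s * (U \<omega> * W \<omega>) \<partial>M)"
    by (simp add: power2_sum power_mult_distrib mult_ac)
  also have "\<dots> = s\<^sup>2 * (\<integral>\<omega>. (U \<omega>)\<^sup>2 \<partial>M) + (\<integral>\<omega>. (W \<omega>)\<^sup>2 \<partial>M)"
    using ints orth by simp
  finally show "(\<integral>\<omega>. iexp (s * U \<omega> + W \<omega>) \<partial>M)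
      = exp (- (s\<^sup>2 * (\<integral>\<omega>. (U \<omega>)\<^sup>2 \<partial>M) + (\<integral>\<omega>. (W \<omega>)\<^sup>2 \<partial>M)) / 2)"
    using forms_char[OF forms_add[OF sU W]] by (simp only:)
qed

section \<open>The Kalman error for fixed inputs\<close>

abbreviation obs :: "(nat \<Rightarrow> real^'d) \<Rightarrow> nat \<Rightarrow> 'a \<Rightarrow> real" where
  "obs z j \<omega> \<equiv> w \<omega> \<bullet> z j + eps j \<omega>"

abbreviation est :: "(nat \<Rightarrow> real^'d) \<Rightarrow> nat \<Rightarrow> 'a \<Rightarrow> real^'d" where
  "est z n \<omega> \<equiv> kalman_mean V r z (\<lambda>j. obs z j \<omega>) n"

abbreviation err :: "(nat \<Rightarrow> real^'d) \<Rightarrow> nat \<Rightarrow> 'a \<Rightarrow> real^'d" where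
  "err z n \<omega> \<equiv> w \<omega> - est z n \<omega>"

lemma obs_forms: "j < n \<Longrightarrow> obs z j \<in> forms n"
  using forms_add[OF forms_w[of "z j"] forms_eps] by (simp add: inner_commute)

text \<open>For fixed inputs the gains are constants, so the estimate is linear in the
  outputs.\<close>

lemma est_forms: "(\<lambda>\<omega>. c \<bullet> est z n \<omega>) \<in> forms n"
proof (induction n arbitrary: c)
  case (Suc n)
  define P where "P = kalman_cov V r z n"
  define k where "k = c \<bullet> (P *v z n) / (z n \<bullet> (P *v z n) + r)"
  have est_F: "(\<lambda>\<omega>. b \<bullet> est z n \<omega>) \<in> forms (Suc n)" for b by (rule forms_Suc[OF Suc])
  have "obs z n \<in> forms (Suc n)" by (rule obs_forms) simp
  then have "(\<lambda>\<omega>. obs z n \<omega> - z n \<bullet> est z n \<omega>) \<in> forms (Suc n)"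
    using est_F by (rule forms_diff)
  then have "(\<lambda>\<omega>. k * (obs z n \<omega> - z n \<bullet> est z n \<omega>)) \<in> forms (Suc n)"
    by (rule forms_scale)
  with est_F have "(\<lambda>\<omega>. c \<bullet> est z n \<omega> + k * (obs z n \<omega> - z n \<bullet> est z n \<omega>)) \<in> forms (Suc n)"
    by (rule forms_add)
  also have "(\<lambda>\<omega>. c \<bullet> est z n \<omega> + k * (obs z n \<omega> - z n \<bullet> est z n \<omega>)) = (\<lambda>\<omega>. c \<bullet> est z (Suc n) \<omega>)"
    by (auto simp: P_def k_def inner_add_right)
  finally show ?case .
qed (simp add: forms_zero)

lemma err_forms: "(\<lambda>\<omega>. c \<bullet> err z n \<omega>) \<in> forms n"
  using forms_diff[OF forms_w est_forms] by (simp add: inner_diff_right)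

text \<open>The three claims need each other. The coefficient \<open>k c\<close> is the regression
  coefficient of the old error on the innovation, so the new error is orthogonal to the innovation.
  Orthogonality to the estimate enters because the newest output is the innovation plus a functional
  of the old estimate; orthogonality to older outputs persists because the innovation is orthogonal
  to them too.\<close>

lemma err_filter:
  shows err_cov: "\<And>c d. (\<integral>\<omega>. (c \<bullet> err z n \<omega>) * (d \<bullet> err z n \<omega>) \<partial>M) = c \<bullet> (kalman_cov V r z n *v d)"
    and err_est: "\<And>c d. (\<integral>\<omega>. (c \<bullet> err z n \<omega>) * (d \<bullet> est z n \<omega>) \<partial>M) = 0"
    and err_obs: "\<And>c j. j < n \<Longrightarrow> (\<integral>\<omega>. (c \<bullet> err z n \<omega>) * obs z j \<omega> \<partial>M) = 0"
proof (induction n)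
  case 0
  show "(\<integral>\<omega>. (c \<bullet> err z 0 \<omega>) * (d \<bullet> err z 0 \<omega>) \<partial>M) = c \<bullet> (kalman_cov V r z 0 *v d)" for c d
    by (simp add: w_cov)
  show "(\<integral>\<omega>. (c \<bullet> err z 0 \<omega>) * (d \<bullet> est z 0 \<omega>) \<partial>M) = 0" for c d by simp
  show "j < 0 \<Longrightarrow> (\<integral>\<omega>. (c \<bullet> err z 0 \<omega>) * obs z j \<omega> \<partial>M) = 0" for c j by simp
next
  case (Suc n)
  define P where "P = kalman_cov V r z n"
  define s where "s = z n \<bullet> (P *v z n) + r"
  define k where "k c = c \<bullet> (P *v z n) / s" for c
  \<comment> \<open>The innovation: the newest output minus its prediction
    \<open>z n \<bullet> est z n \<omega>\<close>.\<close>
  define inno where "inno = (\<lambda>\<omega>. z n \<bullet> err z n \<omega> + eps n \<omega>)"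
  have cov: "(\<integral>\<omega>. (c \<bullet> err z n \<omega>) * (d \<bullet> err z n \<omega>) \<partial>M) = c \<bullet> (P *v d)" for c d
    using Suc(1) P_def by simp
  have sym: "c \<bullet> (P *v d) = d \<bullet> (P *v c)" for c d
    using cov[of c d] cov[of d c] by (simp add: mult.commute)
  \<comment> \<open>By the induction hypothesis this is the second moment of the error in direction
    \<open>z n\<close>; adding the positive \<open>r\<close> keeps the denominator \<open>s\<close>
    away from zero.\<close>
  have "0 \<le> z n \<bullet> (P *v z n)"
    unfolding cov[symmetric] by (intro integral_nonneg_AE) simp
  then have s: "0 < s" using r_pos by (simp add: s_def)
  have err_F: "(\<lambda>\<omega>. c \<bullet> err z n \<omega>) \<in> forms (Suc n)" for c by (rule forms_Suc[OF err_forms])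
  have err'_F: "(\<lambda>\<omega>. c \<bullet> err z (Suc n) \<omega>) \<in> forms (Suc n)" for c by (rule err_forms)
  have est_F: "(\<lambda>\<omega>. c \<bullet> est z n \<omega>) \<in> forms (Suc n)" for c by (rule forms_Suc[OF est_forms])
  have eps_F: "eps n \<in> forms (Suc n)" by (rule forms_eps) simp
  have inno_F: "inno \<in> forms (Suc n)" unfolding inno_def by (rule forms_add[OF err_F eps_F])
  have err': "c \<bullet> err z (Suc n) \<omega> = c \<bullet> err z n \<omega> - k c * inno \<omega>" for c \<omega>
    by (simp add: inno_def k_def s_def P_def inner_diff_right inner_add_right inner_commute algebra_simps
        add_divide_distrib diff_divide_distrib)
  have est': "d \<bullet> est z (Suc n) \<omega> = d \<bullet> est z n \<omega> + k d * inno \<omega>" for d \<omega>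
    by (simp add: inno_def k_def s_def P_def inner_diff_right inner_add_right inner_commute algebra_simps
        add_divide_distrib diff_divide_distrib)
  have err_inno: "(\<integral>\<omega>. (c \<bullet> err z n \<omega>) * inno \<omega> \<partial>M) = c \<bullet> (P *v z n)" for c
  proof -
    have "(\<integral>\<omega>. (c \<bullet> err z n \<omega>) * inno \<omega> \<partial>M)
      = (\<integral>\<omega>. (c \<bullet> err z n \<omega>) * (z n \<bullet> err z n \<omega>) + (c \<bullet> err z n \<omega>) * eps n \<omega> \<partial>M)"
      unfolding inno_def by (simp only: distrib_left)
    also have "\<dots> = (\<integral>\<omega>. (c \<bullet> err z n \<omega>) * (z n \<bullet> err z n \<omega>) \<partial>M) + (\<integral>\<omega>. (c \<bullet> err z n \<omega>) * eps n \<omega> \<partial>M)"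
      by (intro Bochner_Integration.integral_add forms_mult[OF err_F err_F] forms_mult[OF err_F eps_F])
    also have "\<dots> = c \<bullet> (P *v z n)" by (simp only: cov forms_orth[OF err_forms] add_0_right)
    finally show ?thesis .
  qed
  have est_inno: "(\<integral>\<omega>. inno \<omega> * (c \<bullet> est z n \<omega>) \<partial>M) = 0" for c
  proof -
    have "(\<integral>\<omega>. inno \<omega> * (c \<bullet> est z n \<omega>) \<partial>M)
      = (\<integral>\<omega>. (z n \<bullet> err z n \<omega>) * (c \<bullet> est z n \<omega>) + eps n \<omega> * (c \<bullet> est z n \<omega>) \<partial>M)"
      unfolding inno_def by (simp only: distrib_right)
    also have "\<dots> = (\<integral>\<omega>. (z n \<bullet> err z n \<omega>) * (c \<bullet> est z n \<omega>) \<partial>M) + (\<integral>\<omega>. eps n \<omega> * (c \<bullet> est z n \<omega>) \<partial>M)"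
      by (intro Bochner_Integration.integral_add forms_mult[OF err_F est_F] forms_mult[OF eps_F est_F])
    also have "\<dots> = 0" by (simp only: Suc(2) forms_orth'[OF est_forms] add_0_right)
    finally show ?thesis .
  qed
  have inno_inno: "(\<integral>\<omega>. inno \<omega> * inno \<omega> \<partial>M) = s"
  proof -
    have "(\<integral>\<omega>. inno \<omega> * inno \<omega> \<partial>M)
      = (\<integral>\<omega>. (z n \<bullet> err z n \<omega>) * inno \<omega> + (eps n \<omega> * (z n \<bullet> err z n \<omega>) + eps n \<omega> * eps n \<omega>) \<partial>M)"
      unfolding inno_def by (simp only: distrib_left distrib_right add_ac)
    also have "\<dots> = (\<integral>\<omega>. (z n \<bullet> err z n \<omega>) * inno \<omega> \<partial>M)
        + ((\<integral>\<omega>. eps n \<omega> * (z n \<bullet> err z n \<omega>) \<partial>M) + (\<integral>\<omega>. eps n \<omega> * eps n \<omega> \<partial>M))"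
      using forms_mult[OF err_F inno_F, of "z n"] forms_mult[OF eps_F err_F, of "z n"] forms_mult[OF eps_F eps_F]
      by (simp only: Bochner_Integration.integral_add Bochner_Integration.integrable_add)
    also have "\<dots> = s"
      by (simp only: err_inno forms_orth'[OF err_forms] eps_var[unfolded power2_eq_square] s_def add_0_left)
    finally show ?thesis .
  qed
  have err'_minus: "(\<integral>\<omega>. (c \<bullet> err z (Suc n) \<omega>) * f \<omega> \<partial>M)
      = (\<integral>\<omega>. (c \<bullet> err z n \<omega>) * f \<omega> \<partial>M) - k c * (\<integral>\<omega>. inno \<omega> * f \<omega> \<partial>M)"
    if f: "f \<in> forms (Suc n)" for c f
    unfolding err' left_diff_distrib mult.assoc
    using forms_mult[OF err_F f, of c] forms_mult[OF inno_F f] by simp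
  \<comment> \<open>The two terms are \<open>c \<bullet> (P *v z n)\<close> and
    \<open>k c * s\<close>; the definition of \<open>k\<close> makes them equal.\<close>
  have err'_inno: "(\<integral>\<omega>. (c \<bullet> err z (Suc n) \<omega>) * inno \<omega> \<partial>M) = 0" for c
    unfolding err'_minus[OF inno_F] err_inno inno_inno using s by (simp add: k_def)
  have err'_est: "(\<integral>\<omega>. (c \<bullet> err z (Suc n) \<omega>) * (d \<bullet> est z n \<omega>) \<partial>M) = 0" for c d
    unfolding err'_minus[OF est_F] est_inno Suc(2) by simp
  show "(\<integral>\<omega>. (c \<bullet> err z (Suc n) \<omega>) * (d \<bullet> est z (Suc n) \<omega>) \<partial>M) = 0" for c d
  proof -
    have "(\<integral>\<omega>. (c \<bullet> err z (Suc n) \<omega>) * (d \<bullet> est z (Suc n) \<omega>) \<partial>M)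
      = (\<integral>\<omega>. (c \<bullet> err z (Suc n) \<omega>) * (d \<bullet> est z n \<omega>) + k d * ((c \<bullet> err z (Suc n) \<omega>) * inno \<omega>) \<partial>M)"
      unfolding est' by (simp only: distrib_left mult.left_commute)
    also have "\<dots> = (\<integral>\<omega>. (c \<bullet> err z (Suc n) \<omega>) * (d \<bullet> est z n \<omega>) \<partial>M)
        + k d * (\<integral>\<omega>. (c \<bullet> err z (Suc n) \<omega>) * inno \<omega> \<partial>M)"
      using forms_mult[OF err'_F est_F, of c d] forms_mult[OF err'_F inno_F, of c]
      by (simp only: Bochner_Integration.integral_add integrable_mult_right integral_mult_right_zero)
    finally show ?thesis by (simp only: err'_est err'_inno mult_zero_right add_0_right)
  qed
  show "(\<integral>\<omega>. (c \<bullet> err z (Suc n) \<omega>) * (d \<bullet> err z (Suc n) \<omega>) \<partial>M) = c \<bullet> (kalman_cov V r z (Suc n) *v d)" for c d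
  proof -
    \<comment> \<open>Only the second factor is expanded. Its innovation part is orthogonal to the
      new error, so what remains is the moment of the new with the old error, and the rank-one
      correction arises once.\<close>
    have "(\<integral>\<omega>. (c \<bullet> err z (Suc n) \<omega>) * (d \<bullet> err z (Suc n) \<omega>) \<partial>M)
      = (\<integral>\<omega>. (c \<bullet> err z (Suc n) \<omega>) * (d \<bullet> err z n \<omega>) - k d * ((c \<bullet> err z (Suc n) \<omega>) * inno \<omega>) \<partial>M)"
      unfolding err'[of d] by (simp only: right_diff_distrib mult.left_commute)
    also have "\<dots> = (\<integral>\<omega>. (c \<bullet> err z (Suc n) \<omega>) * (d \<bullet> err z n \<omega>) \<partial>M)
        - k d * (\<integral>\<omega>. (c \<bullet> err z (Suc n) \<omega>) * inno \<omega> \<partial>M)"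
      using forms_mult[OF err'_F err_F, of c d] forms_mult[OF err'_F inno_F, of c]
      by (simp only: Bochner_Integration.integral_diff integrable_mult_right integral_mult_right_zero)
    also have "\<dots> = (\<integral>\<omega>. (c \<bullet> err z (Suc n) \<omega>) * (d \<bullet> err z n \<omega>) \<partial>M)"
      by (simp only: err'_inno mult_zero_right diff_0_right)
    also have "\<dots> = c \<bullet> (P *v d) - k c * (d \<bullet> (P *v z n))"
      unfolding err'_minus[OF err_F] cov using err_inno[of d] by (simp only: mult.commute)
    also have "\<dots> = c \<bullet> (kalman_cov V r z (Suc n) *v d)"
      by (simp add: P_def[symmetric] s_def[symmetric] k_def matrix_vector_mult_diff_rdistrib
          scaleR_matrix_vector_assoc[symmetric] outer_mult_vec inner_diff_right inner_commute divide_inverse mult_ac)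
    finally show ?thesis .
  qed
  show "(\<integral>\<omega>. (c \<bullet> err z (Suc n) \<omega>) * obs z j \<omega> \<partial>M) = 0" if j: "j < Suc n" for c j
  proof (cases "j = n")
    case True
    have "obs z n \<omega> = inno \<omega> + z n \<bullet> est z n \<omega>" for \<omega>
      by (simp add: inno_def inner_diff_right inner_commute)
    then have "(\<integral>\<omega>. (c \<bullet> err z (Suc n) \<omega>) * obs z j \<omega> \<partial>M)
      = (\<integral>\<omega>. (c \<bullet> err z (Suc n) \<omega>) * inno \<omega> + (c \<bullet> err z (Suc n) \<omega>) * (z n \<bullet> est z n \<omega>) \<partial>M)"
      unfolding True by (simp only: distrib_left)
    also have "\<dots> = 0"
      using forms_mult[OF err'_F inno_F, of c] forms_mult[OF err'_F est_F, of c "z n"]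
      by (simp only: Bochner_Integration.integral_add err'_inno err'_est add_0_right)
    finally show ?thesis .
  next
    case False
    with j have j: "j < n" by simp
    have "(\<integral>\<omega>. inno \<omega> * obs z j \<omega> \<partial>M)
      = (\<integral>\<omega>. (z n \<bullet> err z n \<omega>) * obs z j \<omega> + eps n \<omega> * obs z j \<omega> \<partial>M)"
      unfolding inno_def by (rule Bochner_Integration.integral_cong[OF refl]) (rule distrib_right)
    also have "\<dots> = (\<integral>\<omega>. (z n \<bullet> err z n \<omega>) * obs z j \<omega> \<partial>M) + (\<integral>\<omega>. eps n \<omega> * obs z j \<omega> \<partial>M)"
      by (intro Bochner_Integration.integral_add forms_mult[OF err_forms obs_forms[OF j]]
          forms_mult[OF eps_F obs_forms[OF that]])
    also have "\<dots> = 0" by (simp only: Suc(3)[OF j] forms_orth'[OF obs_forms[OF j]] add_0_right)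
    finally show ?thesis
      unfolding err'_minus[OF obs_forms[OF that]] Suc(3)[OF j] by simp
  qed
qed

lemma inner_kalman_cov_nonneg: "0 \<le> c \<bullet> (kalman_cov V r z n *v c)"
  unfolding err_cov[symmetric] by (intro integral_nonneg_AE) auto

lemma inner_kalman_cov_commute: "c \<bullet> (kalman_cov V r z n *v d) = d \<bullet> (kalman_cov V r z n *v c)"
  unfolding err_cov[symmetric] by (simp only: mult.commute)

text \<open>Each observation subtracts a nonnegative multiple of a square. The bound is uniform in
  \<open>z\<close>, so it survives the integration over random inputs.\<close>

lemma inner_kalman_cov_le: "c \<bullet> (kalman_cov V r z n *v c) \<le> c \<bullet> (V *v c)"
proof (induction n)
  case (Suc n)
  have "0 < z n \<bullet> (kalman_cov V r z n *v z n) + r"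
    using inner_kalman_cov_nonneg[of "z n" z n] r_pos by simp
  then have "0 \<le> inverse (z n \<bullet> (kalman_cov V r z n *v z n) + r) * (c \<bullet> (kalman_cov V r z n *v z n))\<^sup>2"
    by simp
  then have "c \<bullet> (kalman_cov V r z (Suc n) *v c) \<le> c \<bullet> (kalman_cov V r z n *v c)"
    by (simp add: matrix_vector_mult_diff_rdistrib scaleR_matrix_vector_assoc[symmetric] outer_mult_vec
        inner_diff_right inner_commute power2_eq_square mult.assoc)
  with Suc show ?case by simp
qed simp

end

subsection \<open>Conditional mean and covariance\<close>

lemma measurable_cond_exp: "cond_exp M F f \<in> borel_measurable F"
  unfolding cond_exp_def by simp

lemma (in sigma_finite_subalgebra) cond_exp_eqI:
  assumes "\<And>b. b \<in> Basis \<Longrightarrow> AE \<omega> in M. real_cond_exp M F (\<lambda>\<omega>. f \<omega> \<bullet> b) \<omega> = g \<omega> \<bullet> b"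
  shows "AE \<omega> in M. cond_exp M F f \<omega> = g \<omega>"
proof -
  have "AE \<omega> in M. \<forall>b\<in>Basis. real_cond_exp M F (\<lambda>\<omega>. f \<omega> \<bullet> b) \<omega> = g \<omega> \<bullet> b"
    by (intro AE_finite_allI finite_Basis assms)
  then show ?thesis
    by eventually_elim (simp add: cond_exp_def euclidean_representation)
qed

lemma (in sigma_finite_subalgebra) cond_exp_cong:
  assumes "AE \<omega> in M. f \<omega> = g \<omega>" and [measurable]: "f \<in> borel_measurable M" "g \<in> borel_measurable M"
  shows "AE \<omega> in M. cond_exp M F f \<omega> = cond_exp M F g \<omega>"
proof (rule cond_exp_eqI)
  fix b :: 'b assume b: "b \<in> Basis"
  have "AE \<omega> in M. real_cond_exp M F (\<lambda>\<omega>. f \<omega> \<bullet> b) \<omega> = real_cond_exp M F (\<lambda>\<omega>. g \<omega> \<bullet> b) \<omega>"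
    by (intro real_cond_exp_cong) (use assms(1) in auto)
  then show "AE \<omega> in M. real_cond_exp M F (\<lambda>\<omega>. f \<omega> \<bullet> b) \<omega> = cond_exp M F g \<omega> \<bullet> b"
    using b by (simp add: cond_exp_def inner_sum_left_Basis)
qed

text \<open>The defining property is tested coordinatewise on indicators.
  \<open>G \<in> sets M\<close> is bundled with the vanishing integral to match the form in which
  \<open>joint_algebra_integral_zero\<close> delivers both.\<close>

lemma (in sigma_finite_subalgebra) cond_exp_charact:
  fixes f g :: "'a \<Rightarrow> 'b::euclidean_space"
  assumes zero: "\<And>G b. G \<in> sets F \<Longrightarrow> b \<in> Basis \<Longrightarrow>
      G \<in> sets M \<and> (\<integral>\<omega>. indicator G \<omega> * (f \<omega> \<bullet> b - g \<omega> \<bullet> b) \<partial>M) = 0"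
    and f: "\<And>b. b \<in> Basis \<Longrightarrow> integrable M (\<lambda>\<omega>. f \<omega> \<bullet> b)"
    and g: "\<And>b. b \<in> Basis \<Longrightarrow> integrable M (\<lambda>\<omega>. g \<omega> \<bullet> b)"
    and [measurable]: "g \<in> borel_measurable F"
  shows "AE \<omega> in M. cond_exp M F f \<omega> = g \<omega>"
proof (rule cond_exp_eqI, rule real_cond_exp_charact)
  fix b :: 'b and G assume b: "b \<in> Basis" and G: "G \<in> sets F"
  have GM: "G \<in> sets M" using zero[OF G b] by simp
  have "integrable M (\<lambda>\<omega>. indicator G \<omega> * (f \<omega> \<bullet> b))" "integrable M (\<lambda>\<omega>. indicator G \<omega> * (g \<omega> \<bullet> b))"
    using integrable_mult_indicator[OF GM f[OF b]] integrable_mult_indicator[OF GM g[OF b]] by simp_all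
  then show "(\<integral>\<omega>\<in>G. f \<omega> \<bullet> b \<partial>M) = (\<integral>\<omega>\<in>G. g \<omega> \<bullet> b \<partial>M)"
    using zero[OF G b] by (simp add: set_lebesgue_integral_def right_diff_distrib)
qed (use f g in auto)

context linear_gaussian
begin

text \<open>By \<open>err_obs\<close> the error is orthogonal to every combination of outputs, so
  \<open>forms_pair\<close> factorizes the integral. The factor that vanishes is the mean of
  \<open>U\<close> when \<open>h\<close> is the identity, and the mean of
  \<open>(U \<omega>)\<^sup>2 - p\<close> when \<open>h\<close> is the shifted square.\<close>

lemma err_char:
  fixes t :: "nat \<Rightarrow> real"
  shows err_char1: "(\<integral>\<omega>. complex_of_real (c \<bullet> err z n \<omega>) * iexp (\<Sum>j<n. t j * obs z j \<omega>) \<partial>M) = 0"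
    and err_char2: "(\<integral>\<omega>. complex_of_real ((c \<bullet> err z n \<omega>)\<^sup>2 - c \<bullet> (kalman_cov V r z n *v c))
      * iexp (\<Sum>j<n. t j * obs z j \<omega>) \<partial>M) = 0"
proof -
  define U where "U = (\<lambda>\<omega>. c \<bullet> err z n \<omega>)"
  define W where "W = (\<lambda>\<omega>. \<Sum>j<n. t j * obs z j \<omega>)"
  define p where "p = c \<bullet> (kalman_cov V r z n *v c)"
  have U: "U \<in> forms n" unfolding U_def by (rule err_forms)
  have "(\<lambda>\<omega>. t j * obs z j \<omega>) \<in> forms n" if "j \<in> {..<n}" for j
    by (rule forms_scale[OF obs_forms]) (use that in simp)
  then have W: "W \<in> forms n" unfolding W_def by (rule forms_sum)
  have "(\<integral>\<omega>. U \<omega> * W \<omega> \<partial>M) = (\<integral>\<omega>. (\<Sum>j<n. t j * (U \<omega> * obs z j \<omega>)) \<partial>M)"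
    unfolding W_def by (simp only: sum_distrib_left mult.left_commute)
  also have "\<dots> = (\<Sum>j<n. t j * (\<integral>\<omega>. U \<omega> * obs z j \<omega> \<partial>M))"
    using forms_mult[OF U obs_forms] by (subst Bochner_Integration.integral_sum) simp_all
  also have "\<dots> = 0" unfolding U_def by (simp add: err_obs)
  finally have orth: "(\<integral>\<omega>. U \<omega> * W \<omega> \<partial>M) = 0" .
  have "(\<integral>\<omega>. complex_of_real (U \<omega>) * iexp (W \<omega>) \<partial>M) = 0"
    using forms_pair[OF U W orth, of "\<lambda>x. x"] forms_integrable[OF U] forms_mean[OF U] by simp
  then show "(\<integral>\<omega>. complex_of_real (c \<bullet> err z n \<omega>) * iexp (\<Sum>j<n. t j * obs z j \<omega>) \<partial>M) = 0"
    unfolding U_def W_def .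
  have "(\<integral>\<omega>. (U \<omega>)\<^sup>2 \<partial>M) = p"
    unfolding U_def p_def power2_eq_square by (rule err_cov)
  then have "(\<integral>\<omega>. (U \<omega>)\<^sup>2 - p \<partial>M) = 0"
    using forms_square[OF U] by (simp add: prob_space)
  moreover have "integrable M (\<lambda>\<omega>. (U \<omega>)\<^sup>2 - p)" using forms_square[OF U] by simp
  ultimately have "(\<integral>\<omega>. complex_of_real ((U \<omega>)\<^sup>2 - p) * iexp (W \<omega>) \<partial>M) = 0"
    using forms_pair[OF U W orth, of "\<lambda>x. x\<^sup>2 - p"] by simp
  then show "(\<integral>\<omega>. complex_of_real ((c \<bullet> err z n \<omega>)\<^sup>2 - c \<bullet> (kalman_cov V r z n *v c))
      * iexp (\<Sum>j<n. t j * obs z j \<omega>) \<partial>M) = 0"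
    unfolding U_def W_def p_def .
qed

section \<open>The filter with random inputs\<close>

definition Y :: "nat \<Rightarrow> 'a \<Rightarrow> real" where
  "Y j \<omega> = w \<omega> \<bullet> X j \<omega> + eps j \<omega>"

definition filter_mean :: "nat \<Rightarrow> 'a \<Rightarrow> real^'d" where
  "filter_mean n \<omega> = kalman_mean V r (\<lambda>j. X j \<omega>) (\<lambda>j. Y j \<omega>) n"

definition filter_cov :: "nat \<Rightarrow> 'a \<Rightarrow> real^'d^'d" where
  "filter_cov n \<omega> = kalman_cov V r (\<lambda>j. X j \<omega>) n"

definition filter_err :: "nat \<Rightarrow> 'a \<Rightarrow> real^'d" where
  "filter_err n \<omega> = w \<omega> - filter_mean n \<omega>"

lemma measurable_Y [measurable]: "Y j \<in> borel_measurable M"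
  unfolding Y_def by simp

lemma measurable_filter_mean [measurable]: "filter_mean n \<in> borel_measurable M"
  unfolding filter_mean_def by (rule measurable_kalman_mean) simp_all

lemma measurable_filter_err [measurable]: "filter_err n \<in> borel_measurable M"
  unfolding filter_err_def by simp

lemma measurable_filter_cov [measurable]: "filter_cov n \<in> borel_measurable M"
  unfolding filter_cov_def by (rule measurable_kalman_cov) simp_all

text \<open>The first component of the pair supplies the inputs, the second the weight and the
  noises; this separation is what \<open>freeze\<close> works on.\<close>

lemma measurable_frozen:
  shows measurable_frozen_obs:
      "(\<lambda>p. obs (\<lambda>j. X j (fst p)) j (snd p)) \<in> borel_measurable (A \<Otimes>\<^sub>M B)"
    and measurable_frozen_err:
      "(\<lambda>p. err (\<lambda>j. X j (fst p)) n (snd p)) \<in> borel_measurable (A \<Otimes>\<^sub>M B)"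
    and measurable_frozen_cov:
      "(\<lambda>p. kalman_cov V r (\<lambda>j. X j (fst p)) n) \<in> borel_measurable (A \<Otimes>\<^sub>M B)"
proof -
  have [measurable]: "(\<lambda>p. X j (fst p)) \<in> borel_measurable (A \<Otimes>\<^sub>M B)" for j
    by (rule measurable_compose[OF measurable_fst X_meas])
  have [measurable]: "(\<lambda>p. w (snd p)) \<in> borel_measurable (A \<Otimes>\<^sub>M B)"
    by (rule measurable_compose[OF measurable_snd w_meas])
  have [measurable]: "(\<lambda>p. eps j (snd p)) \<in> borel_measurable (A \<Otimes>\<^sub>M B)" for j
    by (rule measurable_compose[OF measurable_snd eps_meas])
  show obs [measurable]: "(\<lambda>p. obs (\<lambda>j. X j (fst p)) j (snd p)) \<in> borel_measurable (A \<Otimes>\<^sub>M B)" for j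
    by simp
  have "(\<lambda>p. est (\<lambda>j. X j (fst p)) n (snd p)) \<in> borel_measurable (A \<Otimes>\<^sub>M B)"
    by (rule measurable_kalman_mean) simp_all
  then show "(\<lambda>p. err (\<lambda>j. X j (fst p)) n (snd p)) \<in> borel_measurable (A \<Otimes>\<^sub>M B)"
    by (rule borel_measurable_diff[rotated]) simp
  show "(\<lambda>p. kalman_cov V r (\<lambda>j. X j (fst p)) n) \<in> borel_measurable (A \<Otimes>\<^sub>M B)"
    by (rule measurable_kalman_cov) simp
qed

lemma filter_err_frozen: "filter_err n \<omega> = err (\<lambda>j. X j \<omega>) n \<omega>"
  by (simp add: filter_err_def filter_mean_def Y_def)

text \<open>By Tonelli the inner second moment is a frozen covariance, which
  \<open>c \<bullet> (V *v c)\<close> bounds uniformly in the inputs.\<close>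

lemma filter_err_square: "integrable M (\<lambda>\<omega>. (c \<bullet> filter_err n \<omega>)\<^sup>2)"
proof (rule integrableI_bounded)
  let ?F = "\<lambda>p. ennreal ((c \<bullet> err (\<lambda>j. X j (fst p)) n (snd p))\<^sup>2)"
  have F: "?F \<in> borel_measurable (A \<Otimes>\<^sub>M B)"
    using measurable_frozen_err by measurable
  have "(\<integral>\<^sup>+\<omega>. ennreal (norm ((c \<bullet> filter_err n \<omega>)\<^sup>2)) \<partial>M) = (\<integral>\<^sup>+\<omega>. ?F (\<omega>, \<omega>) \<partial>M)"
    by (simp add: filter_err_frozen)
  also have "\<dots> = (\<integral>\<^sup>+\<omega>. (\<integral>\<^sup>+\<omega>'. ?F (\<omega>, \<omega>') \<partial>M) \<partial>M)"
    by (rule nn_integral_freeze[OF subalg_A subalg_B indep_AB F])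
  also have "\<dots> = (\<integral>\<^sup>+\<omega>. ennreal (c \<bullet> (kalman_cov V r (\<lambda>j. X j \<omega>) n *v c)) \<partial>M)"
  proof (rule nn_integral_cong)
    fix \<omega>
    let ?U = "\<lambda>\<omega>'. c \<bullet> err (\<lambda>j. X j \<omega>) n \<omega>'"
    have "(\<integral>\<^sup>+\<omega>'. ennreal ((?U \<omega>')\<^sup>2) \<partial>M) = ennreal (\<integral>\<omega>'. (?U \<omega>')\<^sup>2 \<partial>M)"
      by (intro nn_integral_eq_integral forms_square[OF err_forms]) simp
    also have "(\<integral>\<omega>'. (?U \<omega>')\<^sup>2 \<partial>M) = c \<bullet> (kalman_cov V r (\<lambda>j. X j \<omega>) n *v c)"
      unfolding power2_eq_square by (rule err_cov)
    finally show "(\<integral>\<^sup>+\<omega>'. ?F (\<omega>, \<omega>') \<partial>M) = ennreal (c \<bullet> (kalman_cov V r (\<lambda>j. X j \<omega>) n *v c))"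
      by simp
  qed
  also have "\<dots> \<le> (\<integral>\<^sup>+\<omega>. ennreal (c \<bullet> (V *v c)) \<partial>M)"
    by (intro nn_integral_mono ennreal_leI inner_kalman_cov_le)
  also have "\<dots> < \<infinity>" by (simp add: emeasure_space_1)
  finally show "(\<integral>\<^sup>+\<omega>. ennreal (norm ((c \<bullet> filter_err n \<omega>)\<^sup>2)) \<partial>M) < \<infinity>" .
qed simp

lemma filter_err_mult: "integrable M (\<lambda>\<omega>. (c \<bullet> filter_err n \<omega>) * (d \<bullet> filter_err n \<omega>))"
  by (rule integrable_mult_of_squares[OF _ _ filter_err_square filter_err_square]) simp_all

lemma filter_err_integrable: "integrable M (\<lambda>\<omega>. c \<bullet> filter_err n \<omega>)"
  by (rule integrable_of_square[OF _ filter_err_square]) simp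

text \<open>The quadratic form lies between zero and that of \<open>V\<close>; symmetry and
  polarization extend this to \<open>c\<close> and \<open>d\<close>.\<close>

lemma filter_cov_integrable: "integrable M (\<lambda>\<omega>. c \<bullet> (filter_cov n \<omega> *v d))"
proof -
  have sq: "integrable M (\<lambda>\<omega>. c \<bullet> (filter_cov n \<omega> *v c))" for c
  proof (rule integrable_const_bound[where B = "c \<bullet> (V *v c)"])
    show "AE \<omega> in M. norm (c \<bullet> (filter_cov n \<omega> *v c)) \<le> c \<bullet> (V *v c)"
      using inner_kalman_cov_nonneg inner_kalman_cov_le by (simp add: filter_cov_def)
  qed simp
  have eq: "c \<bullet> (filter_cov n \<omega> *v d) = ((c + d) \<bullet> (filter_cov n \<omega> *v (c + d))
      - c \<bullet> (filter_cov n \<omega> *v c) - d \<bullet> (filter_cov n \<omega> *v d)) / 2" for \<omega>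
    using inner_kalman_cov_commute[of c "\<lambda>j. X j \<omega>" n d]
    by (simp add: filter_cov_def matrix_vector_right_distrib inner_add_left inner_add_right)
  show ?thesis unfolding eq by (intro integrable_divide_zero Bochner_Integration.integrable_diff sq)
qed

text \<open>The event \<open>a\<close> and the filter covariance depend on the inputs only. Freezing
  the inputs turns them into constants and leaves the integrals of \<open>err_char\<close>;
  \<open>joint_algebra_integral_zero\<close> passes from the exponentials to arbitrary
  events.\<close>

lemma filter_zero:
  assumes G: "G \<in> sets (joint_algebra M A Y n)"
  shows filter_err_zero: "G \<in> sets M \<and> (\<integral>\<omega>. indicator G \<omega> * (c \<bullet> filter_err n \<omega>) \<partial>M) = 0"
    and filter_square_zero: "(\<integral>\<omega>. indicator G \<omega> * ((c \<bullet> filter_err n \<omega>)\<^sup>2 - c \<bullet> (filter_cov n \<omega> *v c)) \<partial>M) = 0"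
proof -
  \<comment> \<open>Common pattern of both claims: the first argument of \<open>f\<close> fixes the
    inputs, the second drives the weight and the noises, and \<open>f\<close> is used on the
    diagonal.\<close>
  have zero: "(\<integral>\<omega>. complex_of_real (indicator a \<omega> * f (\<omega>, \<omega>)) * iexp (\<Sum>j<n. t j * Y j \<omega>) \<partial>M) = 0"
    if a: "a \<in> sets A" and f: "f \<in> borel_measurable (A \<Otimes>\<^sub>M B)"
      and int: "integrable M (\<lambda>\<omega>. f (\<omega>, \<omega>))"
      and frozen: "\<And>\<omega>. (\<integral>\<omega>'. complex_of_real (f (\<omega>, \<omega>')) * iexp (\<Sum>j<n. t j * obs (\<lambda>j. X j \<omega>) j \<omega>') \<partial>M) = 0"
    for a t and f :: "'a \<times> 'a \<Rightarrow> real"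
  proof -
    define F where "F p = complex_of_real (indicator a (fst p) * f p)
      * iexp (\<Sum>j<n. t j * obs (\<lambda>j. X j (fst p)) j (snd p))" for p
    have [measurable]: "f \<in> borel_measurable (A \<Otimes>\<^sub>M B)" by (rule f)
    have [measurable]: "(\<lambda>p. indicator a (fst p) :: real) \<in> borel_measurable (A \<Otimes>\<^sub>M B)"
      using a by measurable
    note [measurable] = measurable_frozen_obs
    have F: "F \<in> borel_measurable (A \<Otimes>\<^sub>M B)" unfolding F_def by measurable
    have diag: "F (\<omega>, \<omega>) = complex_of_real (indicator a \<omega> * f (\<omega>, \<omega>)) * iexp (\<Sum>j<n. t j * Y j \<omega>)" for \<omega>
      by (simp add: F_def Y_def)
    have aM: "a \<in> sets M" using a subalg_A by (auto simp: subalgebra_def)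
    have "integrable M (\<lambda>\<omega>. complex_of_real (indicator a \<omega> * f (\<omega>, \<omega>)))"
      using integrable_mult_indicator[OF aM int] by (intro integrable_of_real) simp
    then have "integrable M (\<lambda>\<omega>. F (\<omega>, \<omega>))"
      unfolding diag by (rule integrable_mult_iexp) simp
    moreover have "(\<integral>\<omega>'. F (\<omega>, \<omega>') \<partial>M) = 0" for \<omega>
    proof -
      have "(\<integral>\<omega>'. F (\<omega>, \<omega>') \<partial>M) = (\<integral>\<omega>'. complex_of_real (indicator a \<omega>)
          * (complex_of_real (f (\<omega>, \<omega>')) * iexp (\<Sum>j<n. t j * obs (\<lambda>j. X j \<omega>) j \<omega>')) \<partial>M)"
        by (simp only: F_def fst_conv snd_conv of_real_mult mult.assoc)
      also have "\<dots> = 0" by (simp only: integral_mult_right_zero frozen mult_zero_right)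
      finally show ?thesis .
    qed
    ultimately have "(\<integral>\<omega>. F (\<omega>, \<omega>) \<partial>M) = 0"
      by (intro integral_freeze_zero[OF subalg_A subalg_B indep_AB F])
    then show ?thesis by (simp only: diag)
  qed
  let ?f1 = "\<lambda>p. c \<bullet> err (\<lambda>j. X j (fst p)) n (snd p)"
  let ?f2 = "\<lambda>p. (?f1 p)\<^sup>2 - c \<bullet> (kalman_cov V r (\<lambda>j. X j (fst p)) n *v c)"
  note [measurable] = measurable_frozen_err measurable_frozen_cov
  have f1: "?f1 \<in> borel_measurable (A \<Otimes>\<^sub>M B)" by (intro borel_measurable_inner) simp_all
  have f2: "?f2 \<in> borel_measurable (A \<Otimes>\<^sub>M B)"
    by (intro borel_measurable_diff borel_measurable_power f1) simp
  have d1: "?f1 (\<omega>, \<omega>) = c \<bullet> filter_err n \<omega>" for \<omega> by (simp add: filter_err_frozen)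
  have d2: "?f2 (\<omega>, \<omega>) = (c \<bullet> filter_err n \<omega>)\<^sup>2 - c \<bullet> (filter_cov n \<omega> *v c)" for \<omega>
    by (simp add: filter_err_frozen filter_cov_def)
  have i2: "integrable M (\<lambda>\<omega>. (c \<bullet> filter_err n \<omega>)\<^sup>2 - c \<bullet> (filter_cov n \<omega> *v c))"
    by (intro Bochner_Integration.integrable_diff filter_err_square filter_cov_integrable)
  show "G \<in> sets M \<and> (\<integral>\<omega>. indicator G \<omega> * (c \<bullet> filter_err n \<omega>) \<partial>M) = 0"
  proof (rule joint_algebra_integral_zero[OF subalg_A filter_err_integrable _ _ G])
    fix a t assume "a \<in> sets A"
    from zero[OF this f1, unfolded d1, OF filter_err_integrable, of t]
    show "(\<integral>\<omega>. complex_of_real (indicator a \<omega> * (c \<bullet> filter_err n \<omega>)) * iexp (\<Sum>j<n. t j * Y j \<omega>) \<partial>M) = 0"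
      by (simp only: fst_conv snd_conv err_char1)
  qed simp
  have "G \<in> sets M \<and> (\<integral>\<omega>. indicator G \<omega> * ((c \<bullet> filter_err n \<omega>)\<^sup>2 - c \<bullet> (filter_cov n \<omega> *v c)) \<partial>M) = 0"
  proof (rule joint_algebra_integral_zero[OF subalg_A i2 _ _ G])
    fix a t assume "a \<in> sets A"
    from zero[OF this f2, unfolded d2, OF i2, of t]
    show "(\<integral>\<omega>. complex_of_real (indicator a \<omega> * ((c \<bullet> filter_err n \<omega>)\<^sup>2 - c \<bullet> (filter_cov n \<omega> *v c)))
        * iexp (\<Sum>j<n. t j * Y j \<omega>) \<partial>M) = 0"
      by (simp only: fst_conv snd_conv err_char2)
  qed simp
  then show "(\<integral>\<omega>. indicator G \<omega> * ((c \<bullet> filter_err n \<omega>)\<^sup>2 - c \<bullet> (filter_cov n \<omega> *v c)) \<partial>M) = 0" by simp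
qed

text \<open>Polarization of \<open>filter_square_zero\<close> at \<open>c + d\<close>,
  \<open>c\<close> and \<open>d\<close>, using the symmetry of the filter covariance.\<close>

lemma filter_cov_zero:
  assumes G: "G \<in> sets (joint_algebra M A Y n)"
  shows "(\<integral>\<omega>. indicator G \<omega> * ((c \<bullet> filter_err n \<omega>) * (d \<bullet> filter_err n \<omega>) - c \<bullet> (filter_cov n \<omega> *v d)) \<partial>M) = 0"
proof -
  define q where "q c \<omega> = indicator G \<omega> * ((c \<bullet> filter_err n \<omega>)\<^sup>2 - c \<bullet> (filter_cov n \<omega> *v c))" for c \<omega>
  have GM: "G \<in> sets M" using filter_err_zero[OF G] by simp
  have "integrable M (\<lambda>\<omega>. (c \<bullet> filter_err n \<omega>)\<^sup>2 - c \<bullet> (filter_cov n \<omega> *v c))" for c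
    by (intro Bochner_Integration.integrable_diff filter_err_square filter_cov_integrable)
  from integrable_mult_indicator[OF GM this] have q: "integrable M (q c)" for c
    unfolding q_def[abs_def] by simp
  have q0: "integral\<^sup>L M (q c) = 0" for c unfolding q_def by (rule filter_square_zero[OF G])
  have eq: "indicator G \<omega> * ((c \<bullet> filter_err n \<omega>) * (d \<bullet> filter_err n \<omega>) - c \<bullet> (filter_cov n \<omega> *v d))
      = (q (c + d) \<omega> - q c \<omega> - q d \<omega>) / 2" for \<omega>
    using inner_kalman_cov_commute[of c "\<lambda>j. X j \<omega>" n d]
    by (simp add: q_def filter_cov_def matrix_vector_right_distrib inner_add_left inner_add_right
        power2_eq_square algebra_simps)
  have "(\<integral>\<omega>. (q (c + d) \<omega> - q c \<omega> - q d \<omega>) / 2 \<partial>M) = 0"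
    using q by (simp add: q0)
  then show ?thesis by (simp only: eq)
qed

text \<open>\<open>F\<close> is only sandwiched. It is large enough to measure the first
  \<open>n\<close> inputs and outputs, hence the filter mean and covariance, and small enough for
  the orthogonality relations to hold on its events. This leaves room for an information vector that
  records updates as well.\<close>

lemma cond_exp_filter:
  assumes F: "subalgebra M F" and F_le: "sets F \<subseteq> sets (joint_algebra M A Y n)"
    and XF: "\<And>j. j < n \<Longrightarrow> X j \<in> borel_measurable F" and YF: "\<And>j. j < n \<Longrightarrow> Y j \<in> borel_measurable F"
  shows cond_exp_filter_mean: "AE \<omega> in M. cond_exp M F w \<omega> = filter_mean n \<omega>"
    and cond_exp_filter_cov: "AE \<omega> in M. cond_exp M F (\<lambda>\<omega>. outer (filter_err n \<omega>) (filter_err n \<omega>)) \<omega> = filter_cov n \<omega>"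
proof -
  interpret F: finite_measure_subalgebra M F by unfold_locales (rule F)
  have w_int: "integrable M (\<lambda>\<omega>. w \<omega> \<bullet> b)" for b
    using forms_integrable[OF forms_w[of b]] by (simp add: inner_commute)
  show "AE \<omega> in M. cond_exp M F w \<omega> = filter_mean n \<omega>"
  proof (rule F.cond_exp_charact)
    fix G and b :: "real^'d" assume "G \<in> sets F"
    then show "G \<in> sets M \<and> (\<integral>\<omega>. indicator G \<omega> * (w \<omega> \<bullet> b - filter_mean n \<omega> \<bullet> b) \<partial>M) = 0"
      using filter_err_zero[of G n b] F_le by (auto simp: filter_err_def inner_diff_right inner_commute)
  next
    fix b :: "real^'d"
    show "integrable M (\<lambda>\<omega>. w \<omega> \<bullet> b)" by (rule w_int)
    have "filter_mean n \<omega> \<bullet> b = w \<omega> \<bullet> b - b \<bullet> filter_err n \<omega>" for \<omega>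
      by (simp add: filter_err_def inner_diff_right inner_commute)
    then show "integrable M (\<lambda>\<omega>. filter_mean n \<omega> \<bullet> b)"
      using w_int filter_err_integrable by simp
  next
    show "filter_mean n \<in> borel_measurable F"
      unfolding filter_mean_def by (rule measurable_kalman_mean) (use XF YF in auto)
  qed
  show "AE \<omega> in M. cond_exp M F (\<lambda>\<omega>. outer (filter_err n \<omega>) (filter_err n \<omega>)) \<omega> = filter_cov n \<omega>"
  proof (rule F.cond_exp_charact)
    fix b :: "real^'d^'d" assume "b \<in> Basis"
    then obtain i j where b: "b = axis i (axis j 1)" by (auto simp: Basis_vec_def)
    have e: "outer (filter_err n \<omega>) (filter_err n \<omega>) \<bullet> b
        = (axis i 1 \<bullet> filter_err n \<omega>) * (axis j 1 \<bullet> filter_err n \<omega>)" for \<omega>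
      by (simp add: b outer_def inner_axis inner_axis')
    have c: "filter_cov n \<omega> \<bullet> b = axis i 1 \<bullet> (filter_cov n \<omega> *v axis j 1)" for \<omega>
      by (simp add: b inner_axis inner_axis' matrix_vector_mul_component)
    show "integrable M (\<lambda>\<omega>. outer (filter_err n \<omega>) (filter_err n \<omega>) \<bullet> b)"
      unfolding e by (rule filter_err_mult)
    show "integrable M (\<lambda>\<omega>. filter_cov n \<omega> \<bullet> b)"
      unfolding c by (rule filter_cov_integrable)
    fix G assume "G \<in> sets F"
    then have G: "G \<in> sets (joint_algebra M A Y n)" using F_le by auto
    show "G \<in> sets M \<and> (\<integral>\<omega>. indicator G \<omega> * (outer (filter_err n \<omega>) (filter_err n \<omega>) \<bullet> b
        - filter_cov n \<omega> \<bullet> b) \<partial>M) = 0"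
      unfolding e c using filter_err_zero[OF G] filter_cov_zero[OF G] by blast
  next
    show "filter_cov n \<in> borel_measurable F"
      unfolding filter_cov_def by (rule measurable_kalman_cov) (use XF in auto)
  qed
qed

end

subsection \<open>The data model\<close>

context prob_space
begin

section \<open>Centered Gaussian variables\<close>

text \<open>The characteristic function is recorded at frequency one; other frequencies come from
  applying the predicate to multiples of the variable. The form includes variance zero, so
  degenerate weights need no separate treatment in sums.\<close>

definition centered_gaussian :: "('a \<Rightarrow> real) \<Rightarrow> bool" where
  "centered_gaussian Z \<longleftrightarrow> Z \<in> borel_measurable M \<and> integrable M (\<lambda>\<omega>. (Z \<omega>)\<^sup>2)
     \<and> integral\<^sup>L M Z = 0 \<and> (\<integral>\<omega>. iexp (Z \<omega>) \<partial>M) = exp (- (\<integral>\<omega>. (Z \<omega>)\<^sup>2 \<partial>M) / 2)"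

text \<open>The vanishing mean forces \<open>m = 0\<close>; then \<open>Z \<omega> / s\<close> is
  standard normal, and its characteristic function at \<open>s\<close> is that of \<open>Z\<close>
  at one.\<close>

lemma centered_gaussian_distributed:
  fixes Z :: "'a \<Rightarrow> real"
  assumes Z: "distributed M lborel Z (normal_density m s)" and s: "0 < s" and mean: "integral\<^sup>L M Z = 0"
  shows "centered_gaussian Z"
proof -
  have Zm[measurable]: "Z \<in> borel_measurable M" using Z unfolding distributed_def by simp
  have m: "m = 0" using normal_distributed_expectation[OF s Z] mean by simp
  have var: "(\<integral>\<omega>. (Z \<omega>)\<^sup>2 \<partial>M) = s\<^sup>2" using normal_distributed_variance[OF s Z] mean by simp
  have "integrable M (\<lambda>\<omega>. (Z \<omega>)\<^sup>2)"
    using distributed_integrable[OF Z, of "\<lambda>z. z\<^sup>2"] integrable_normal_moment[OF s, of m 2] m by simp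
  moreover have "(\<integral>\<omega>. iexp (Z \<omega>) \<partial>M) = exp (- s\<^sup>2 / 2)"
  proof -
    have D: "distributed M lborel (\<lambda>\<omega>. Z \<omega> / s) std_normal_density"
      using Z normal_standard_normal_convert[OF s, of Z m] m by simp
    have "distr M borel (\<lambda>\<omega>. Z \<omega> / s) = distr M lborel (\<lambda>\<omega>. Z \<omega> / s)"
      by (intro distr_cong) simp_all
    also have "\<dots> = std_normal_distribution"
      using D unfolding distributed_def by simp
    finally have "char (distr M borel (\<lambda>\<omega>. Z \<omega> / s)) s = exp (- (s\<^sup>2) / 2)"
      by (simp only: char_std_normal_distribution)
    moreover have "char (distr M borel (\<lambda>\<omega>. Z \<omega> / s)) s = (\<integral>\<omega>. iexp (s * (Z \<omega> / s)) \<partial>M)"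
      unfolding char_def by (rule integral_distr) simp_all
    moreover have "s * (Z \<omega> / s) = Z \<omega>" for \<omega> using s by simp
    ultimately show ?thesis by (simp only:)
  qed
  ultimately show ?thesis unfolding centered_gaussian_def var using mean by simp
qed

lemma centered_gaussian_AE:
  assumes [measurable]: "Z \<in> borel_measurable M" and Z: "AE \<omega> in M. Z \<omega> = m" and mean: "integral\<^sup>L M Z = 0"
  shows "centered_gaussian Z"
proof -
  have "integral\<^sup>L M Z = (\<integral>\<omega>. m \<partial>M)" by (rule integral_cong_AE) (use Z in auto)
  then have m: "m = 0" using mean by (simp add: prob_space)
  have 1: "AE \<omega> in M. (Z \<omega>)\<^sup>2 = 0" using Z by eventually_elim (simp add: m)
  have "integrable M (\<lambda>\<omega>. (Z \<omega>)\<^sup>2) \<longleftrightarrow> integrable M (\<lambda>\<omega>. 0 :: real)"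
    by (rule integrable_cong_AE) (use 1 in auto)
  moreover have "(\<integral>\<omega>. (Z \<omega>)\<^sup>2 \<partial>M) = 0" using 1 by (rule integral_eq_zero_AE)
  moreover have "(\<integral>\<omega>. iexp (Z \<omega>) \<partial>M) = (\<integral>\<omega>. 1 \<partial>M)"
  proof (rule integral_cong_AE)
    show "AE \<omega> in M. iexp (Z \<omega>) = 1" using Z by eventually_elim (simp add: m)
  qed auto
  ultimately show ?thesis unfolding centered_gaussian_def using mean by (simp add: prob_space)
qed

lemma centered_gaussian_inner:
  fixes Z :: "'a \<Rightarrow> 'b::euclidean_space"
  assumes "gaussian M Z" and "zero_mean M Z"
  shows "centered_gaussian (\<lambda>\<omega>. c \<bullet> Z \<omega>)"
proof -
  have [measurable]: "Z \<in> borel_measurable M" using assms(1) by (simp add: gaussian_def)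
  have mean: "(\<integral>\<omega>. c \<bullet> Z \<omega> \<partial>M) = 0" using assms(2) by (simp add: zero_mean_def)
  obtain m s where "0 < s \<and> distributed M lborel (\<lambda>\<omega>. c \<bullet> Z \<omega>) (normal_density m s) \<or> (AE \<omega> in M. c \<bullet> Z \<omega> = m)"
    using assms(1) unfolding gaussian_def by meson
  then show ?thesis
  proof
    assume "0 < s \<and> distributed M lborel (\<lambda>\<omega>. c \<bullet> Z \<omega>) (normal_density m s)"
    then show ?thesis using mean by (intro centered_gaussian_distributed[of _ m s]) auto
  next
    assume "AE \<omega> in M. c \<bullet> Z \<omega> = m"
    then show ?thesis using mean by (intro centered_gaussian_AE[of _ m]) auto
  qed
qed

text \<open>Under independence characteristic functions multiply and variances of centered variables
  add, which agree because the exponent is linear in the variance.\<close>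

lemma centered_gaussian_add:
  assumes f: "centered_gaussian f" and g: "centered_gaussian g" and indep: "indep_var borel f borel g"
  shows "centered_gaussian (\<lambda>\<omega>. f \<omega> + g \<omega>)"
proof -
  note F = f[unfolded centered_gaussian_def] and G = g[unfolded centered_gaussian_def]
  have [measurable]: "f \<in> borel_measurable M" "g \<in> borel_measurable M" using F G by auto
  have sq: "integrable M (\<lambda>\<omega>. (f \<omega>)\<^sup>2)" "integrable M (\<lambda>\<omega>. (g \<omega>)\<^sup>2)" using F G by auto
  then have int: "integrable M f" "integrable M g" by (auto intro: integrable_of_square)
  have fg: "integrable M (\<lambda>\<omega>. f \<omega> * g \<omega>)" by (rule integrable_mult_of_squares) (use sq in auto)
  have "(\<integral>\<omega>. f \<omega> * g \<omega> \<partial>M) = 0"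
    using indep_var_lebesgue_integral[OF indep int] F by simp
  then have var: "(\<integral>\<omega>. (f \<omega> + g \<omega>)\<^sup>2 \<partial>M) = (\<integral>\<omega>. (f \<omega>)\<^sup>2 \<partial>M) + (\<integral>\<omega>. (g \<omega>)\<^sup>2 \<partial>M)"
    using sq fg by (simp add: power2_sum mult.assoc)
  have char1: "char (distr M borel h) 1 = (\<integral>\<omega>. iexp (h \<omega>) \<partial>M)" if "h \<in> borel_measurable M" for h
    unfolding char_def using that by (subst integral_distr) simp_all
  have "(\<integral>\<omega>. iexp (f \<omega> + g \<omega>) \<partial>M) = (\<integral>\<omega>. iexp (f \<omega>) \<partial>M) * (\<integral>\<omega>. iexp (g \<omega>) \<partial>M)"
    using char_distr_add[OF indep, of 1] by (simp only: char1 borel_measurable_add \<open>f \<in> _\<close> \<open>g \<in> _\<close>)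
  also have "\<dots> = exp (- (\<integral>\<omega>. (f \<omega> + g \<omega>)\<^sup>2 \<partial>M) / 2)"
    using F G unfolding var by (simp flip: of_real_mult exp_add add: add_divide_distrib)
  finally show ?thesis
    unfolding centered_gaussian_def
    using F G int integrable_square_add[OF _ _ sq] by simp
qed

lemma centered_gaussian_sum:
  assumes "finite S" and "indep_vars (\<lambda>_. borel) Z S" and "\<And>s. s \<in> S \<Longrightarrow> centered_gaussian (Z s)"
  shows "centered_gaussian (\<lambda>\<omega>. \<Sum>s\<in>S. Z s \<omega>)"
  using assms
proof (induction S rule: finite_induct)
  case empty
  show ?case by (simp add: centered_gaussian_AE[of _ 0])
next
  case (insert i S)
  have "indep_vars (\<lambda>_. borel) Z S" using insert.prems(1) by (rule indep_vars_subset) auto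
  then have "centered_gaussian (\<lambda>\<omega>. Z i \<omega> + (\<Sum>s\<in>S. Z s \<omega>))"
    using insert by (intro centered_gaussian_add indep_vars_sum) auto
  then show ?case using insert.hyps by simp
qed

lemma indep_vars_expectation_mult:
  fixes Z :: "'i \<Rightarrow> 'a \<Rightarrow> real"
  assumes "indep_vars (\<lambda>_. borel) Z S" "i \<in> S" "j \<in> S" "i \<noteq> j" "integrable M (Z i)" "integrable M (Z j)"
  shows "(\<integral>\<omega>. Z i \<omega> * Z j \<omega> \<partial>M) = integral\<^sup>L M (Z i) * integral\<^sup>L M (Z j)"
proof -
  have "(\<integral>\<omega>. (\<Prod>s\<in>{i, j}. Z s \<omega>) \<partial>M) = (\<Prod>s\<in>{i, j}. integral\<^sup>L M (Z s))"
    using assms by (intro indep_vars_lebesgue_integral indep_vars_subset[OF assms(1)]) auto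
  then show ?thesis using assms(4) by simp
qed

end

section \<open>Algebras generated by groups of independent sources\<close>

text \<open>The set systems of \<open>mutually_independent\<close>, named so that several sources
  can be grouped into one algebra.\<close>

definition source_sets ::
  "'a measure \<Rightarrow> ('a \<Rightarrow> real^'d) \<Rightarrow> (int \<Rightarrow> 'a \<Rightarrow> real^'d) \<Rightarrow> (int \<Rightarrow> 'a \<Rightarrow> real) \<Rightarrow> source \<Rightarrow> 'a set set" where
  "source_sets M w x eps s = (case s of
            Weight \<Rightarrow> {w -` A \<inter> space M | A. A \<in> sets borel}
          | Input k \<Rightarrow> {x k -` A \<inter> space M | A. A \<in> sets borel}
          | Noise k \<Rightarrow> {eps k -` A \<inter> space M | A. A \<in> sets borel})"

definition source_algebra where
  "source_algebra M w x eps S = sigma (space M) (\<Union>s\<in>S. source_sets M w x eps s)"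

lemma Int_stable_vimage: "Int_stable {f -` A \<inter> S |A. A \<in> sets N}"
proof (rule Int_stableI)
  fix a b assume "a \<in> {f -` A \<inter> S |A. A \<in> sets N}" "b \<in> {f -` A \<inter> S |A. A \<in> sets N}"
  then obtain A B where "a = f -` A \<inter> S" "b = f -` B \<inter> S" "A \<in> sets N" "B \<in> sets N" by blast
  then show "a \<inter> b \<in> {f -` A \<inter> S |A. A \<in> sets N}"
    by (intro CollectI exI[of _ "A \<inter> B"]) auto
qed

lemma source_sets_subset: "source_sets M w x eps s \<subseteq> Pow (space M)"
  by (auto simp: source_sets_def split: source.splits)

lemma sets_source_algebra:
  "sets (source_algebra M w x eps S) = sigma_sets (space M) (\<Union>s\<in>S. source_sets M w x eps s)"
  unfolding source_algebra_def by (rule sets_measure_of) (use source_sets_subset in blast)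

lemma space_source_algebra [simp]: "space (source_algebra M w x eps S) = space M"
  unfolding source_algebra_def by (rule space_measure_of) (use source_sets_subset in blast)

lemma measurable_source_algebra:
  fixes f :: "'a \<Rightarrow> 'b::topological_space"
  assumes "s \<in> S" and "{f -` B \<inter> space M |B. B \<in> sets (borel :: 'b measure)} \<subseteq> source_sets M w x eps s"
  shows "f \<in> borel_measurable (source_algebra M w x eps S)"
proof (rule measurableI)
  fix B :: "'b set" assume "B \<in> sets borel"
  then have "f -` B \<inter> space M \<in> (\<Union>s\<in>S. source_sets M w x eps s)" using assms by blast
  then show "f -` B \<inter> space (source_algebra M w x eps S) \<in> sets (source_algebra M w x eps S)"
    unfolding sets_source_algebra space_source_algebra by (rule sigma_sets.Basic)
qed simp

text \<open>Every source contributes an intersection-stable system, so independence passes to the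
  algebras generated by disjoint groups. The two groups are indexed by \<open>bool\<close> to fit
  \<open>indep_sets_collect_sigma\<close>.\<close>

lemma (in prob_space) source_algebra_independent:
  assumes indep: "indep_sets (source_sets M w x eps) (S \<union> T)" and "S \<inter> T = {}"
  shows "subalgebra M (source_algebra M w x eps S)"
    and "a \<in> sets (source_algebra M w x eps S) \<Longrightarrow> b \<in> sets (source_algebra M w x eps T) \<Longrightarrow>
      prob (a \<inter> b) = prob a * prob b"
proof -
  have sub: "source_sets M w x eps s \<subseteq> sets M" if "s \<in> S \<union> T" for s
    using indep that unfolding indep_sets_def by blast
  show "subalgebra M (source_algebra M w x eps S)"
    unfolding subalgebra_def sets_source_algebra space_source_algebra
    using sub by (auto intro!: sets.sigma_sets_subset)
  have "indep_sets (\<lambda>j. sigma_sets (space M) (\<Union>s\<in>(if j then S else T). source_sets M w x eps s)) (UNIV :: bool set)"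
  proof (rule indep_sets_collect_sigma)
    have "(\<Union>j. if j then S else T) = S \<union> T" by (auto split: if_splits)
    then show "indep_sets (source_sets M w x eps) (\<Union>j. if j then S else T)" using indep by simp
    show "Int_stable (source_sets M w x eps i)" for i
      by (auto simp: source_sets_def Int_stable_vimage split: source.split)
    show "disjoint_family_on (\<lambda>j. if j then S else T) UNIV"
      using assms(2) by (auto simp: disjoint_family_on_def)
  qed
  from indep_setsD[OF this, of UNIV "\<lambda>j. if j then a else b"]
  show "a \<in> sets (source_algebra M w x eps S) \<Longrightarrow> b \<in> sets (source_algebra M w x eps T) \<Longrightarrow>
      prob (a \<inter> b) = prob a * prob b"
    unfolding sets_source_algebra by (simp add: UNIV_bool Int_commute mult.commute)
qed

lemma integral_outer:
  assumes "integrable M (\<lambda>\<omega>. outer (f \<omega>) (f \<omega>))"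
  shows "(\<integral>\<omega>. (c \<bullet> f \<omega>) * (d \<bullet> f \<omega>) \<partial>M) = c \<bullet> ((\<integral>\<omega>. outer (f \<omega>) (f \<omega>) \<partial>M) *v d)"
proof -
  have "linear (\<lambda>S. c \<bullet> (S *v d))"
    by (rule linearI) (simp_all add: matrix_vector_mult_add_rdistrib inner_add_right
        scaleR_matrix_vector_assoc[symmetric])
  then have "bounded_linear (\<lambda>S. c \<bullet> (S *v d))" by (simp add: linear_conv_bounded_linear)
  from integral_bounded_linear[OF this assms] show ?thesis
    by (simp add: outer_mult_vec inner_commute mult.commute)
qed

lemma linear_gaussian_source:
  fixes M :: "'a measure" and w :: "'a \<Rightarrow> real^'d"
  assumes "prob_space M" and r: "0 < r"
    and mi: "mutually_independent M w x eps"
    and w0: "zero_mean M w" and eps0: "\<And>k. 0 \<le> k \<Longrightarrow> zero_mean M (eps k)"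
    and cov: "has_covariance M w V"
    and var: "\<And>k. 0 \<le> k \<Longrightarrow> prob_space.variance M (eps k) = r"
    and w_gauss: "gaussian M w" and eps_gauss: "\<And>k. 0 \<le> k \<Longrightarrow> gaussian M (eps k)"
  shows "linear_gaussian M (source_algebra M w x eps (Input ` {0..}))
    (source_algebra M w x eps (insert Weight (Noise ` {0..})))
    w (\<lambda>n. x (int n)) (\<lambda>n. eps (int n)) V r"
proof -
  interpret prob_space M by fact
  let ?S = "Input ` {0..}" and ?T = "insert Weight (Noise ` {0..})"
  let ?A = "source_algebra M w x eps ?S" and ?B = "source_algebra M w x eps ?T"
  have meas[measurable]: "w \<in> borel_measurable M" "0 \<le> k \<Longrightarrow> eps k \<in> borel_measurable M" for k
    using mi by (auto simp: mutually_independent_def)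
  have "indep_sets (source_sets M w x eps) ({Weight} \<union> Input ` {0..} \<union> Noise ` {0..})"
    using mi by (simp add: mutually_independent_def source_sets_def[abs_def])
  also have "{Weight} \<union> Input ` {0..} \<union> Noise ` {0..} = ?S \<union> ?T" by auto
  finally have ind: "indep_sets (source_sets M w x eps) (?S \<union> ?T)" .
  then have ind': "indep_sets (source_sets M w x eps) (?T \<union> ?S)" by (simp add: Un_commute)
  have disj: "?S \<inter> ?T = {}" by auto
  then have disj': "?T \<inter> ?S = {}" by auto
  \<comment> \<open>One real variable per source brings the vector-valued weight and the real noises
    into a single family for \<open>indep_vars\<close>. \<open>Input\<close> gets the filler value
    0; it lies outside the index set \<open>?T\<close>.\<close>
  define Z where "Z c b s \<omega> = (case s of Weight \<Rightarrow> c \<bullet> w \<omega> | Noise k \<Rightarrow> b k * eps k \<omega> | Input k \<Rightarrow> (0 :: real))"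
    for c b s \<omega>
  have Z: "indep_vars (\<lambda>_. borel) (Z c b) ?T" for c b
    unfolding indep_vars_def2
  proof
    show "\<forall>s\<in>?T. random_variable borel (Z c b s)" by (auto simp: Z_def[abs_def])
    show "indep_sets (\<lambda>s. {Z c b s -` B \<inter> space M |B. B \<in> sets borel}) ?T"
    proof (rule indep_sets_mono[OF ind])
      fix s assume s: "s \<in> ?T"
      show "{Z c b s -` B \<inter> space M |B. B \<in> sets borel} \<subseteq> source_sets M w x eps s"
      proof
        fix a assume "a \<in> {Z c b s -` B \<inter> space M |B. B \<in> sets borel}"
        then obtain B where a: "a = Z c b s -` B \<inter> space M" and B: "B \<in> sets borel" by blast
        show "a \<in> source_sets M w x eps s"
        proof (cases s)
          case Weight
          have "(\<lambda>v. c \<bullet> v) -` B \<in> sets borel"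
            using measurable_sets_borel[of "\<lambda>v. c \<bullet> v"] B by simp
          moreover have "a = w -` ((\<lambda>v. c \<bullet> v) -` B) \<inter> space M" by (auto simp: a Weight Z_def)
          ultimately show ?thesis unfolding source_sets_def Weight by auto
        next
          case (Noise k)
          have "(\<lambda>v. b k * v) -` B \<in> sets borel"
            using measurable_sets_borel[of "\<lambda>v. b k * v"] B by simp
          moreover have "a = eps k -` ((\<lambda>v. b k * v) -` B) \<inter> space M" by (auto simp: a Noise Z_def)
          ultimately show ?thesis unfolding source_sets_def Noise by auto
        qed (use s in auto)
      qed
    qed auto
  qed
  have gw: "centered_gaussian (\<lambda>\<omega>. c \<bullet> w \<omega>)" for c by (rule centered_gaussian_inner[OF w_gauss w0])
  have ge: "centered_gaussian (\<lambda>\<omega>. b * eps k \<omega>)" if "0 \<le> k" for b k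
    using centered_gaussian_inner[OF eps_gauss[OF that] eps0[OF that], of b] by simp
  have gZ: "centered_gaussian (Z c b s)" if "s \<in> ?T" for c b s
    using that gw ge by (auto simp: Z_def[abs_def])
  have intZ: "integrable M (Z c b s)" if "s \<in> ?T" for c b s
    using gZ[OF that] integrable_of_square unfolding centered_gaussian_def by blast
  have meanZ: "integral\<^sup>L M (Z c b s) = 0" if "s \<in> ?T" for c b s
    using gZ[OF that] unfolding centered_gaussian_def by blast
  have orthZ: "(\<integral>\<omega>. Z c b s \<omega> * Z c b s' \<omega> \<partial>M) = 0" if "s \<in> ?T" "s' \<in> ?T" "s \<noteq> s'" for c b s s'
    using indep_vars_expectation_mult[OF Z that intZ[OF that(1)] intZ[OF that(2)]] meanZ[OF that(1)] by simp
  show ?thesis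
  proof unfold_locales
    show "subalgebra M ?A" by (rule source_algebra_independent(1)[OF ind disj])
    show "subalgebra M ?B" by (rule source_algebra_independent(1)[OF ind' disj'])
    show "a \<in> sets ?A \<Longrightarrow> b \<in> sets ?B \<Longrightarrow> prob (a \<inter> b) = prob a * prob b" for a b
      by (rule source_algebra_independent(2)[OF ind disj])
    show "x (int j) \<in> borel_measurable ?A" for j
      by (rule measurable_source_algebra[of "Input (int j)"]) (auto simp: source_sets_def)
    show "w \<in> borel_measurable ?B"
      by (rule measurable_source_algebra[of Weight]) (auto simp: source_sets_def)
    show "eps (int j) \<in> borel_measurable ?B" for j
      by (rule measurable_source_algebra[of "Noise (int j)"]) (auto simp: source_sets_def)
    show "0 < r" by (rule r)
    show "integrable M (\<lambda>\<omega>. (c \<bullet> w \<omega>)\<^sup>2)" "(\<integral>\<omega>. c \<bullet> w \<omega> \<partial>M) = 0" for c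
      using gw[of c] by (auto simp: centered_gaussian_def)
    show "integrable M (\<lambda>\<omega>. (eps (int j) \<omega>)\<^sup>2)" "(\<integral>\<omega>. eps (int j) \<omega> \<partial>M) = 0" for j
      using ge[of "int j" 1] by (auto simp: centered_gaussian_def)
    show "(\<integral>\<omega>. (c \<bullet> w \<omega>) * (d \<bullet> w \<omega>) \<partial>M) = c \<bullet> (V *v d)" for c d
      using cov w0 integral_outer[of M w c d] by (simp add: has_covariance_def zero_mean_def)
    show "(\<integral>\<omega>. (eps (int j) \<omega>)\<^sup>2 \<partial>M) = r" for j
      using var[of "int j"] eps0[of "int j"] by (simp add: zero_mean_def)
    show "(\<integral>\<omega>. (c \<bullet> w \<omega>) * eps (int j) \<omega> \<partial>M) = 0" for c j
      using orthZ[of Weight "Noise (int j)" c "\<lambda>_. 1"] by (simp add: Z_def)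
    show "(\<integral>\<omega>. eps (int i) \<omega> * eps (int j) \<omega> \<partial>M) = 0" if "i \<noteq> j" for i j
      using orthZ[of "Noise (int i)" "Noise (int j)" 0 "\<lambda>_. 1"] that by (simp add: Z_def)
    show "(\<integral>\<omega>. iexp (c \<bullet> w \<omega> + (\<Sum>j<n. b j * eps (int j) \<omega>)) \<partial>M)
      = exp (- (\<integral>\<omega>. (c \<bullet> w \<omega> + (\<Sum>j<n. b j * eps (int j) \<omega>))\<^sup>2 \<partial>M) / 2)" for c b n
    proof -
      \<comment> \<open>Noises are numbered by naturals in the locale and by integers in the model;
        \<open>nat\<close> translates the coefficients.\<close>
      define J where "J = (\<lambda>j. Noise (int j)) ` {..<n}"
      have "centered_gaussian (\<lambda>\<omega>. \<Sum>s\<in>insert Weight J. Z c (\<lambda>k. b (nat k)) s \<omega>)"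
      proof (rule centered_gaussian_sum)
        show "indep_vars (\<lambda>_. borel) (Z c (\<lambda>k. b (nat k))) (insert Weight J)"
          by (rule indep_vars_subset[OF Z]) (auto simp: J_def)
        show "finite (insert Weight J)" by (simp add: J_def)
      qed (use gZ in \<open>auto simp: J_def\<close>)
      moreover have "(\<Sum>s\<in>insert Weight J. Z c (\<lambda>k. b (nat k)) s \<omega>)
          = c \<bullet> w \<omega> + (\<Sum>j<n. b j * eps (int j) \<omega>)" for \<omega>
      proof -
        have "(\<Sum>s\<in>J. Z c (\<lambda>k. b (nat k)) s \<omega>) = (\<Sum>j<n. b j * eps (int j) \<omega>)"
          unfolding J_def by (subst sum.reindex) (auto simp: inj_on_def Z_def)
        moreover have "Weight \<notin> J" "finite J" by (auto simp: J_def)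
        ultimately show ?thesis by (simp add: Z_def)
      qed
      ultimately show ?thesis unfolding centered_gaussian_def by (simp only:)
    qed
  qed
qed

subsection \<open>Information algebras\<close>

lemma measurable_info:
  assumes "\<And>j. 0 \<le> j \<Longrightarrow> j \<le> k \<Longrightarrow> x j \<in> borel_measurable N"
    and "\<And>j. 0 \<le> j \<Longrightarrow> j \<le> k \<Longrightarrow> y j \<in> borel_measurable N"
    and "\<And>j. 0 \<le> j \<Longrightarrow> j < k \<Longrightarrow> u j \<in> borel_measurable N"
  shows "info x y u k \<in> measurable N (info_space k)"
  unfolding info_def[abs_def] info_space_def
  by (intro measurable_Pair measurable_restrict) (use assms in auto)

lemma info_in_space: "info x y u k \<omega> \<in> space (info_space k)"
  by (auto simp: info_def info_space_def space_pair_measure space_PiM)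

lemma space_info_algebra [simp]: "space (info_algebra M x y u k) = space M"
  by (simp add: info_algebra_def)

lemma measurable_info_algebra:
  assumes "g \<in> measurable (info_space k) N"
  shows "(\<lambda>\<omega>. g (info x y u k \<omega>)) \<in> measurable (info_algebra M x y u k) N"
proof (rule measurable_compose[OF _ assms])
  show "info x y u k \<in> measurable (info_algebra M x y u k) (info_space k)"
    unfolding info_algebra_def by (rule measurable_vimage_algebra1) (simp add: info_in_space)
qed

lemma measurable_info_algebra_components:
  shows info_algebra_input: "0 \<le> j \<Longrightarrow> j \<le> k \<Longrightarrow> x j \<in> borel_measurable (info_algebra M x y u k)"
    and info_algebra_output: "0 \<le> j \<Longrightarrow> j \<le> k \<Longrightarrow> y j \<in> borel_measurable (info_algebra M x y u k)"
    and info_algebra_update: "0 \<le> j \<Longrightarrow> j < k \<Longrightarrow> u j \<in> borel_measurable (info_algebra M x y u k)"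
proof -
  have 1: "(\<lambda>i. fst i j) \<in> measurable (info_space k) (borel \<Otimes>\<^sub>M borel)" if "0 \<le> j" "j \<le> k"
    unfolding info_space_def
    by (rule measurable_compose[OF measurable_fst measurable_component_singleton]) (use that in simp)
  have 2: "(\<lambda>i. snd i j) \<in> borel_measurable (info_space k)" if "0 \<le> j" "j < k"
    unfolding info_space_def
    by (rule measurable_compose[OF measurable_snd measurable_component_singleton]) (use that in simp)
  show "x j \<in> borel_measurable (info_algebra M x y u k)" if "0 \<le> j" "j \<le> k"
    using measurable_info_algebra[OF measurable_compose[OF 1 measurable_fst], OF that] that
    by (simp add: info_def)
  show "y j \<in> borel_measurable (info_algebra M x y u k)" if "0 \<le> j" "j \<le> k"
    using measurable_info_algebra[OF measurable_compose[OF 1 measurable_snd], OF that] that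
    by (simp add: info_def)
  show "u j \<in> borel_measurable (info_algebra M x y u k)" if "0 \<le> j" "j < k"
    using measurable_info_algebra[OF 2, OF that] that by (simp add: info_def)
qed

lemma sets_info_algebra_subset:
  assumes "info x y u k \<in> measurable N (info_space k)" and "space N = space M"
  shows "sets (info_algebra M x y u k) \<subseteq> sets N"
proof -
  have "sets (info_algebra M x y u k) = {info x y u k -` B \<inter> space M |B. B \<in> sets (info_space k)}"
    unfolding info_algebra_def by (rule sets_vimage_algebra2) (simp add: info_in_space)
  then show ?thesis using measurable_sets[OF assms(1)] assms(2) by auto
qed

lemma info_algebra_eqI:
  assumes "sets (info_algebra M x y u k) = sets (info_algebra M x y' u k)"
  shows "info_algebra M x y u k = info_algebra M x y' u k"
  using assms by (intro measure_eqI) (simp_all add: info_algebra_def vimage_algebra_def emeasure_sigma)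

text \<open>Strong induction on time: an update is a Borel function of the data so far and of
  earlier updates. Hence any algebra that measures the data measures the updates; \<open>N\<close>
  will be \<open>M\<close>, an information algebra and a joint algebra.\<close>

lemma measurable_update:
  assumes "space N = space M"
    and upd: "\<And>k. 0 \<le> k \<Longrightarrow>
           \<exists>\<phi> \<in> borel_measurable (info_space k). \<forall>\<omega>\<in>space M. u k \<omega> = \<phi> (info x y u k \<omega>)"
    and x: "\<And>j. 0 \<le> j \<Longrightarrow> j \<le> k \<Longrightarrow> x j \<in> borel_measurable N"
    and y: "\<And>j. 0 \<le> j \<Longrightarrow> j \<le> k \<Longrightarrow> y j \<in> borel_measurable N"
    and "0 \<le> i" "i \<le> k"
  shows "u i \<in> borel_measurable N"
  using assms(5,6)
proof (induction "nat i" arbitrary: i rule: less_induct)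
  case less
  have "info x y u i \<in> measurable N (info_space i)"
  proof (rule measurable_info)
    show "u j \<in> borel_measurable N" if "0 \<le> j" "j < i" for j
      using less that by simp
  qed (use x y less in auto)
  moreover obtain \<phi> where \<phi>: "\<phi> \<in> borel_measurable (info_space i)" "\<forall>\<omega>\<in>space M. u i \<omega> = \<phi> (info x y u i \<omega>)"
    using upd[OF \<open>0 \<le> i\<close>] by blast
  ultimately have "(\<lambda>\<omega>. \<phi> (info x y u i \<omega>)) \<in> borel_measurable N" using measurable_compose by blast
  then show ?case
    by (rule measurable_cong[THEN iffD2, rotated]) (use \<phi>(2) assms(1) in auto)
qed

text \<open>The value at \<open>k\<close> is the sum of the updates before \<open>k\<close>, so a
  property closed under sums passes to it. It is used for measurability and for
  integrability.\<close>

lemma accumulate_induct: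
  fixes v u :: "int \<Rightarrow> 'a \<Rightarrow> 'b::real_vector"
  assumes "0 \<le> k" and "\<And>\<omega>. v 0 \<omega> = 0" and step: "\<And>k \<omega>. 0 \<le> k \<Longrightarrow> v (k + 1) \<omega> = v k \<omega> + u k \<omega>"
    and P0: "P (\<lambda>_. 0)" and Padd: "\<And>f g. P f \<Longrightarrow> P g \<Longrightarrow> P (\<lambda>\<omega>. f \<omega> + g \<omega>)"
    and Pu: "\<And>j. 0 \<le> j \<Longrightarrow> j < k \<Longrightarrow> P (u j)"
  shows "P (v k)"
  using assms(1) Pu
proof (induction k rule: int_ge_induct)
  case base
  have "v 0 = (\<lambda>_. 0)" using assms(2) by auto
  then show ?case using P0 by simp
next
  case (step k)
  have "v (k + 1) = (\<lambda>\<omega>. v k \<omega> + u k \<omega>)" using assms(3)[OF \<open>0 \<le> k\<close>] by auto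
  then show ?case using step Padd[of "v k" "u k"] by simp
qed

section \<open>Matrix form of the filter equations\<close>

text \<open>\<open>matrix_inv\<close> is defined by choice: existence of an inverse gives its
  two-sided equations, and associativity identifies it with the known one.\<close>

lemma matrix_inv_mat:
  fixes c :: real
  assumes "c \<noteq> 0"
  shows "matrix_inv (mat c :: real^'n^'n) = mat (inverse c)"
proof -
  have 1: "(mat a :: real^'n^'n) ** mat b = mat (a * b)" for a b :: real
    by (auto simp: vec_eq_iff matrix_matrix_mult_def mat_def if_distrib[of "\<lambda>x. x * _"] cong: if_cong)
  then have inv: "(mat c :: real^'n^'n) ** mat (inverse c) = mat 1" "(mat (inverse c) :: real^'n^'n) ** mat c = mat 1"
    using assms by simp_all
  then have "\<exists>S. (mat c :: real^'n^'n) ** S = mat 1 \<and> S ** (mat c :: real^'n^'n) = mat 1" by (intro exI conjI)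
  from someI_ex[OF this] have "(mat c :: real^'n^'n) ** matrix_inv (mat c) = mat 1 \<and> matrix_inv (mat c) ** mat c = (mat 1 :: real^'n^'n)"
    unfolding matrix_inv_def .
  then have left: "matrix_inv (mat c) ** mat c = (mat 1 :: real^'n^'n)" by simp
  have "matrix_inv (mat c :: real^'n^'n) = matrix_inv (mat c) ** (mat c ** mat (inverse c))"
    by (simp only: inv(1) matrix_mul_rid)
  also have "\<dots> = mat (inverse c)" by (simp only: matrix_mul_assoc left matrix_mul_lid)
  finally show ?thesis .
qed

text \<open>The inverted matrix is 1 by 1, so its inverse is a scalar. Symmetry of \<open>S\<close>
  turns the remaining row into the transpose of \<open>S *v z\<close>, which produces the outer
  product.\<close>

lemma riccati_step:
  fixes S :: "real^'d^'d" and z :: "real^'d" and q :: real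
  assumes sym: "\<And>c d. c \<bullet> (S *v d) = d \<bullet> (S *v c)" and s: "z \<bullet> (S *v z) + q \<noteq> 0"
  shows "S - S ** transpose (rowvector z :: real^'d^1)
        ** matrix_inv (rowvector z ** S ** transpose (rowvector z) + mat q) ** rowvector z ** S
      = S - inverse (z \<bullet> (S *v z) + q) *\<^sub>R outer (S *v z) (S *v z)"
proof -
  have symS: "S $ i $ j = S $ j $ i" for i j
    using sym[of "axis i 1" "axis j 1"] by (simp add: inner_axis' matrix_vector_mul_component inner_axis)
  have "(rowvector z ** S ** transpose (rowvector z) + mat q :: real^1^1) = mat (z \<bullet> (S *v z) + q)"
    by (simp add: vec_eq_iff matrix_matrix_mult_def mat_def rowvector_def transpose_def inner_vec_def
        matrix_vector_mult_def sum_distrib_left sum_distrib_right mult_ac)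
      (simp add: symS)
  then have inv: "matrix_inv (rowvector z ** S ** transpose (rowvector z) + mat q :: real^1^1)
      = mat (inverse (z \<bullet> (S *v z) + q))"
    using matrix_inv_mat[OF s] by simp
  show ?thesis unfolding inv
    by (simp add: vec_eq_iff matrix_matrix_mult_def mat_def rowvector_def transpose_def outer_def
        matrix_vector_mult_def sum_distrib_left sum_distrib_right mult_ac symS)
qed

lemma gain_times_innovation:
  fixes S :: "real^'d^'d" and z m :: "real^'d"
  shows "(h *\<^sub>R (S ** transpose (rowvector z :: real^'d^1))) *v (vec y - rowvector z *v m)
    = (h * (y - z \<bullet> m)) *\<^sub>R (S *v z)"
  by (simp add: vec_eq_iff matrix_matrix_mult_def rowvector_def transpose_def inner_vec_def
      matrix_vector_mult_def sum_distrib_left sum_distrib_right mult_ac)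

text \<open>A function known given \<open>F\<close> is its own conditional expectation. In use
  \<open>f\<close> is the current estimate and \<open>g\<close> the weight.\<close>

lemma (in sigma_finite_subalgebra) cond_exp_diff_measurable:
  fixes f g :: "'a \<Rightarrow> 'b::euclidean_space"
  assumes "f \<in> borel_measurable F" "integrable M f" "integrable M g"
  shows "AE \<omega> in M. cond_exp M F (\<lambda>\<omega>. f \<omega> - g \<omega>) \<omega> = f \<omega> - cond_exp M F g \<omega>"
proof (rule cond_exp_eqI)
  fix b :: 'b assume b: "b \<in> Basis"
  have "AE \<omega> in M. real_cond_exp M F (\<lambda>\<omega>. f \<omega> \<bullet> b - g \<omega> \<bullet> b) \<omega>
      = real_cond_exp M F (\<lambda>\<omega>. f \<omega> \<bullet> b) \<omega> - real_cond_exp M F (\<lambda>\<omega>. g \<omega> \<bullet> b) \<omega>"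
    by (rule real_cond_exp_diff) (use assms in auto)
  moreover have "AE \<omega> in M. real_cond_exp M F (\<lambda>\<omega>. f \<omega> \<bullet> b) \<omega> = f \<omega> \<bullet> b"
    by (rule real_cond_exp_F_meas) (use assms in auto)
  ultimately show "AE \<omega> in M. real_cond_exp M F (\<lambda>\<omega>. (f \<omega> - g \<omega>) \<bullet> b) \<omega> = (f \<omega> - cond_exp M F g \<omega>) \<bullet> b"
    by eventually_elim (use b in \<open>simp add: inner_diff_left cond_exp_def inner_sum_left_Basis\<close>)
qed

lemma (in sigma_finite_subalgebra) integrable_cond_exp:
  fixes f :: "'a \<Rightarrow> 'b::euclidean_space"
  assumes "integrable M f"
  shows "integrable M (cond_exp M F f)"
  unfolding cond_exp_def[abs_def]
  by (intro Bochner_Integration.integrable_sum integrable_scaleR_left real_cond_exp_int integrable_inner_left assms)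

context linear_gaussian
begin

lemma filter_cov_Suc:
  "filter_cov (Suc n) \<omega> = filter_cov n \<omega> - filter_cov n \<omega> ** transpose (rowvector (X n \<omega>) :: real^'d^1)
     ** matrix_inv (rowvector (X n \<omega>) ** filter_cov n \<omega> ** transpose (rowvector (X n \<omega>)) + mat r)
     ** rowvector (X n \<omega>) ** filter_cov n \<omega>"
proof -
  have "X n \<omega> \<bullet> (filter_cov n \<omega> *v X n \<omega>) + r \<noteq> 0"
    using inner_kalman_cov_nonneg[of "X n \<omega>" "\<lambda>j. X j \<omega>" n] r_pos by (simp add: filter_cov_def)
  then have "filter_cov n \<omega> - filter_cov n \<omega> ** transpose (rowvector (X n \<omega>) :: real^'d^1)
     ** matrix_inv (rowvector (X n \<omega>) ** filter_cov n \<omega> ** transpose (rowvector (X n \<omega>)) + mat r)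
     ** rowvector (X n \<omega>) ** filter_cov n \<omega>
     = filter_cov n \<omega> - inverse (X n \<omega> \<bullet> (filter_cov n \<omega> *v X n \<omega>) + r)
        *\<^sub>R outer (filter_cov n \<omega> *v X n \<omega>) (filter_cov n \<omega> *v X n \<omega>)"
    by (intro riccati_step) (simp_all add: filter_cov_def inner_kalman_cov_commute)
  then show ?thesis by (simp add: filter_cov_def)
qed

text \<open>Both forms of the gain agree: the updated covariance maps the input to
  \<open>r / s\<close> times its image under \<open>P\<close>, and the factor
  \<open>inverse r\<close> leaves the \<open>1 / s\<close> of \<open>kalman_mean\<close>.\<close>

lemma filter_mean_Suc:
  "filter_mean (Suc n) \<omega> = filter_mean n \<omega>
     + (inverse r *\<^sub>R (filter_cov (Suc n) \<omega> ** transpose (rowvector (X n \<omega>) :: real^'d^1)))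
         *v (vec (Y n \<omega>) - rowvector (X n \<omega>) *v filter_mean n \<omega>)"
proof -
  define P where "P = filter_cov n \<omega>"
  define s where "s = X n \<omega> \<bullet> (P *v X n \<omega>) + r"
  have s: "s > 0"
    using inner_kalman_cov_nonneg[of "X n \<omega>" "\<lambda>j. X j \<omega>" n] r_pos by (simp add: s_def P_def filter_cov_def)
  have "filter_cov (Suc n) \<omega> *v X n \<omega> = P *v X n \<omega> - (inverse s * (s - r)) *\<^sub>R (P *v X n \<omega>)"
    by (simp add: filter_cov_def P_def s_def matrix_vector_mult_diff_rdistrib
        scaleR_matrix_vector_assoc[symmetric] outer_mult_vec inner_commute)
  also have "\<dots> = (1 - inverse s * (s - r)) *\<^sub>R (P *v X n \<omega>)"
    by (simp add: scaleR_left_diff_distrib)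
  also have "1 - inverse s * (s - r) = r / s" using s by (simp add: field_simps)
  finally have "filter_cov (Suc n) \<omega> *v X n \<omega> = (r / s) *\<^sub>R (P *v X n \<omega>)" .
  moreover have "inverse r * t * (r / s) = t / s" for t using r_pos by simp
  ultimately show ?thesis
    by (simp only: gain_times_innovation scaleR_scaleR) (simp add: filter_mean_def P_def s_def filter_cov_def)
qed

end

section \<open>Transfer to the learning machine\<close>

theorem proposition2:
  fixes M :: "'a measure"
    and w :: "'a \<Rightarrow> real^'d"
    and x :: "int \<Rightarrow> 'a \<Rightarrow> real^'d"
    and eps y y_til :: "int \<Rightarrow> 'a \<Rightarrow> real"
    and u w_opt w_kal e_opt e_kal :: "int \<Rightarrow> 'a \<Rightarrow> real^'d"
    and I I_til :: "int \<Rightarrow> 'a measure"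
    and C :: "int \<Rightarrow> 'a \<Rightarrow> real^'d^1"
    and H :: "int \<Rightarrow> 'a \<Rightarrow> real^1^'d"
    and \<Sigma> :: "int \<Rightarrow> 'a \<Rightarrow> real^'d^'d"
    and L Q_mean :: "int \<Rightarrow> real^'d^'d"
    and \<Sigma>_w :: "real^'d^'d"
    and \<sigma> \<gamma> :: real
    and N :: int
  assumes "prob_space M" and "1 \<le> N" and "0 < \<gamma>" and "0 < \<sigma>\<^sup>2"
    \<comment> \<open>data model\<close>
    and "mutually_independent M w x eps"
    and "zero_mean M w"
    and "\<And>k. 0 \<le> k \<Longrightarrow> zero_mean M (x k)"
    and "\<And>k. 0 \<le> k \<Longrightarrow> zero_mean M (eps k)"
    and "has_covariance M w \<Sigma>_w"
    and "\<And>k. 0 \<le> k \<Longrightarrow> prob_space.variance M (eps k) = \<sigma>\<^sup>2"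
    and "\<And>k. 0 \<le> k \<Longrightarrow> integrable M (\<lambda>\<omega>. outer (x k \<omega>) (x k \<omega>))"
    and "gaussian M w"
    and "\<And>k. 0 \<le> k \<Longrightarrow> gaussian M (eps k)"
    and "\<And>k \<omega>. y k \<omega> = w \<omega> \<bullet> x k \<omega> + eps k \<omega>"
    and "\<And>k \<omega>. C k \<omega> = rowvector (x k \<omega>)"
    and "\<And>k. Q_mean k = (\<integral>\<omega>. outer (x k \<omega>) (x k \<omega>) \<partial>M)"
    \<comment> \<open>learning machine\<close>
    and "\<And>\<omega>. w_opt (-1) \<omega> = 0"
    and "\<And>\<omega>. w_opt 0 \<omega> = 0"
    and "\<And>k \<omega>. 0 \<le> k \<Longrightarrow> w_opt (k + 1) \<omega> = w_opt k \<omega> + u k \<omega>"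
    and "\<And>k \<omega>. e_opt k \<omega> = w_opt k \<omega> - w \<omega>"
    and "\<And>k \<omega>. y_til k \<omega> = w_opt k \<omega> \<bullet> x k \<omega> - y k \<omega>"
    and "\<And>k. I k = info_algebra M x y u k"
    and "\<And>k. I_til k = info_algebra M x y_til u k"
    and "\<And>k. 0 \<le> k \<Longrightarrow>
           \<exists>\<phi> \<in> borel_measurable (info_space k). \<forall>\<omega>\<in>space M. u k \<omega> = \<phi> (info x y u k \<omega>)"
    \<comment> \<open>optimal updates up to the horizon, arbitrary integrable updates afterwards\<close>
    and "\<And>k. L k = gain \<gamma> N Q_mean k"
    and "\<And>k. 0 \<le> k \<Longrightarrow> k \<le> N - 1 \<Longrightarrow>
           AE \<omega> in M. u k \<omega> = L k *v cond_exp M (I_til k) (e_opt k) \<omega>"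
    and "\<And>k. N \<le> k \<Longrightarrow> integrable M (u k)"
    \<comment> \<open>Kalman filter\<close>
    and "\<And>k. w_kal k = cond_exp M (I k) w"
    and "\<And>k \<omega>. e_kal k \<omega> = w_kal k \<omega> - w \<omega>"
    and "\<And>\<omega>. \<Sigma> (-1) \<omega> = \<Sigma>_w"
    and "\<And>k. 0 \<le> k \<Longrightarrow> \<Sigma> k = cond_cov M (I_til k) (e_opt k)"
    and "\<And>k \<omega>. H k \<omega> = inverse (\<sigma>\<^sup>2) *\<^sub>R (\<Sigma> k \<omega> ** transpose (C k \<omega>))"
  shows "(\<forall>k. -1 \<le> k \<and> k \<le> N - 1 \<longrightarrow>
            (AE \<omega> in M.
               w_opt (k + 1) \<omega> = w_opt k \<omega> + L k *v (w_opt k \<omega> - cond_exp M (I k) w \<omega>) \<and>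
               w_opt (k + 1) \<omega> = w_opt k \<omega> + L k *v (w_opt k \<omega> - w_kal k \<omega>) \<and>
               w_opt (k + 1) \<omega> = w_opt k \<omega> + L k *v (e_opt k \<omega> - e_kal k \<omega>))) \<and>
         (AE \<omega> in M. w_kal (-1) \<omega> = 0) \<and>
         (\<forall>k\<ge>-1. AE \<omega> in M.
            w_kal (k + 1) \<omega> =
              w_kal k \<omega> + H (k + 1) \<omega> *v (vec (y (k + 1) \<omega>) - C (k + 1) \<omega> *v w_kal k \<omega>)) \<and>
         (\<forall>k\<ge>0. AE \<omega> in M.
            \<Sigma> k \<omega> =
              \<Sigma> (k - 1) \<omega>
              - \<Sigma> (k - 1) \<omega> ** transpose (C k \<omega>)
                  ** matrix_inv (C k \<omega> ** \<Sigma> (k - 1) \<omega> ** transpose (C k \<omega>) + mat (\<sigma>\<^sup>2))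
                  ** C k \<omega> ** \<Sigma> (k - 1) \<omega>)"
proof -
  note w0 = assms(17,18) and w_step = assms(19) and e_def = assms(20) and yt_def = assms(21)
    and I_def = assms(22) and It_def = assms(23) and upd = assms(24) and u_opt = assms(26) and u_int = assms(27)
    and wk_def = assms(28) and ek_def = assms(29) and S0 = assms(30) and S_def = assms(31) and H_def = assms(32)
    and y_def = assms(14) and C_def = assms(15)
  let ?A = "source_algebra M w x eps (Input ` {0..})"
  interpret linear_gaussian M ?A "source_algebra M w x eps (insert Weight (Noise ` {0..}))"
    w "\<lambda>n. x (int n)" "\<lambda>n. eps (int n)" \<Sigma>_w "\<sigma>\<^sup>2"
    using assms(1,4,5,6,8,9,10,12,13) by (rule linear_gaussian_source)
  have Y: "Y n = y (int n)" for n
    by (auto simp: Y_def y_def)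
  have xM: "x k \<in> borel_measurable M" if "0 \<le> k" for k
    using X_meas_M[of "nat k"] that by simp
  have yM: "y k \<in> borel_measurable M" if "0 \<le> k" for k
    using measurable_Y[of "nat k"] that by (simp add: Y)
  have uM: "u k \<in> borel_measurable M" if "0 \<le> k" for k
    by (rule measurable_update[OF refl upd xM yM, of k k]) (use that in auto)
  have uI: "u k \<in> borel_measurable (I k)" if "0 \<le> k" for k
    unfolding I_def
    by (rule measurable_update[OF _ upd, of _ k]) (use that in \<open>auto intro: info_algebra_input info_algebra_output\<close>)
  have w_opt_meas: "w_opt k \<in> borel_measurable K"
    if "0 \<le> k" "\<And>j. 0 \<le> j \<Longrightarrow> j < k \<Longrightarrow> u j \<in> borel_measurable K" for k K
    by (rule accumulate_induct[where P = "\<lambda>f. f \<in> borel_measurable K", OF that(1) w0(2) w_step])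
      (use that(2) in auto)
  \<comment> \<open>\<open>y j\<close> and \<open>y_til j\<close> determine each other through
    \<open>w_opt j \<omega> \<bullet> x j \<omega>\<close>, and \<open>w_opt j\<close> is a sum of
    updates before \<open>j\<close>, which both information vectors record. So both generate the
    same algebra.\<close>
  have I_til: "I_til k = I k" for k
    unfolding I_def It_def
  proof (rule info_algebra_eqI, rule antisym)
    let ?N = "info_algebra M x y u k" and ?N' = "info_algebra M x y_til u k"
    have yt: "y_til j = (\<lambda>\<omega>. w_opt j \<omega> \<bullet> x j \<omega> - y j \<omega>)" for j by (auto simp: yt_def)
    have y: "y j = (\<lambda>\<omega>. w_opt j \<omega> \<bullet> x j \<omega> - y_til j \<omega>)" for j by (auto simp: yt_def)
    have "y_til j \<in> borel_measurable ?N" if j: "0 \<le> j" "j \<le> k" for j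
    proof -
      have "w_opt j \<in> borel_measurable ?N"
        by (rule w_opt_meas[OF j(1)]) (use j in \<open>auto intro: info_algebra_update\<close>)
      then show ?thesis unfolding yt
        by (intro borel_measurable_diff borel_measurable_inner info_algebra_input info_algebra_output j)
    qed
    then show "sets ?N' \<subseteq> sets ?N"
      by (intro sets_info_algebra_subset measurable_info) (auto intro: info_algebra_input info_algebra_update)
    have "y j \<in> borel_measurable ?N'" if j: "0 \<le> j" "j \<le> k" for j
    proof -
      have "w_opt j \<in> borel_measurable ?N'"
        by (rule w_opt_meas[OF j(1)]) (use j in \<open>auto intro: info_algebra_update\<close>)
      then show ?thesis
        by (subst y) (intro borel_measurable_diff borel_measurable_inner info_algebra_input
            info_algebra_output[where y = y_til] j)
    qed
    then show "sets ?N \<subseteq> sets ?N'"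
      by (intro sets_info_algebra_subset measurable_info) (auto intro: info_algebra_input info_algebra_update)
  qed
  have I_sub: "subalgebra M (I k)" for k
  proof -
    have "sets (I k) \<subseteq> sets M" unfolding I_def
      by (intro sets_info_algebra_subset measurable_info xM yM uM) auto
    then show ?thesis by (simp add: subalgebra_def I_def)
  qed
  \<comment> \<open>The number of outputs available at time \<open>k\<close>; in particular
    \<open>n (-1) = 0\<close>, the prior.\<close>
  define n where "n k = nat (k + 1)" for k
  have I_joint: "sets (I k) \<subseteq> sets (joint_algebra M ?A Y (n k))" for k
  proof -
    let ?J = "joint_algebra M ?A Y (n k)"
    have x: "x j \<in> borel_measurable ?J" if "0 \<le> j" for j
      using measurable_joint_algebra[OF subalg_A X_meas[of "nat j"]] that by simp
    have y: "y j \<in> borel_measurable ?J" if "0 \<le> j" "j \<le> k" for j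
      using measurable_joint_algebra_observation[OF subalg_A, of "nat j" "n k" Y] that by (simp add: Y n_def)
    have "u j \<in> borel_measurable ?J" if "0 \<le> j" "j < k" for j
      by (rule measurable_update[OF _ upd x y, of k]) (use that in auto)
    with x y show ?thesis
      unfolding I_def by (intro sets_info_algebra_subset measurable_info) auto
  qed
  have xI: "x (int j) \<in> borel_measurable (I k)" "Y j \<in> borel_measurable (I k)" if "j < n k" for j k
    using that unfolding I_def Y n_def by (auto intro: info_algebra_input info_algebra_output)
  have kal: "AE \<omega> in M. w_kal k \<omega> = filter_mean (n k) \<omega>" for k
    unfolding wk_def by (rule cond_exp_filter_mean[OF I_sub I_joint xI])
  have cov: "AE \<omega> in M. cond_exp M (I k) (\<lambda>\<omega>. outer (filter_err (n k) \<omega>) (filter_err (n k) \<omega>)) \<omega>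
      = filter_cov (n k) \<omega>" for k
    by (rule cond_exp_filter_cov[OF I_sub I_joint xI])
  have w_int: "integrable M w" using assms(6) by (simp add: zero_mean_def)
  have sfs: "sigma_finite_subalgebra M (I k)" for k
  proof -
    interpret finite_measure_subalgebra M "I k" by unfold_locales (rule I_sub)
    show ?thesis ..
  qed
  have e_eq: "e_opt k = (\<lambda>\<omega>. w_opt k \<omega> - w \<omega>)" for k by (auto simp: e_def)
  \<comment> \<open>Before the horizon an update is almost surely a linear image of a conditional
    expectation of \<open>w_opt k \<omega> - w \<omega>\<close>, and \<open>w_opt k\<close> sums
    earlier updates; hence strong induction. From \<open>N\<close> on integrability is
    assumed.\<close>
  have u_integrable: "integrable M (u k)" if "0 \<le> k" for k
    using that
  proof (induction "nat k" arbitrary: k rule: less_induct)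
    case less
    show ?case
    proof (cases "N \<le> k")
      case False
      have "integrable M (w_opt k)"
        by (rule accumulate_induct[where P = "integrable M", OF less.prems w0(2) w_step]) (use less in auto)
      then have "integrable M (cond_exp M (I k) (e_opt k))"
        using w_int unfolding e_eq by (intro sigma_finite_subalgebra.integrable_cond_exp[OF sfs]) auto
      then have "integrable M (\<lambda>\<omega>. L k *v cond_exp M (I k) (e_opt k) \<omega>)"
        by (rule integrable_bounded_linear[OF matrix_vector_mul_bounded_linear])
      then show ?thesis
        using integrable_cong_AE_imp[of M _ "u k"] uM[OF less.prems] u_opt[of k] less.prems False
        by (simp add: I_til eq_commute)
    qed (rule u_int)
  qed
  have w_opt_int: "integrable M (w_opt k)" if "0 \<le> k" for k
    by (rule accumulate_induct[where P = "integrable M", OF that w0(2) w_step]) (use u_integrable in auto)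
  have w_opt_I: "w_opt k \<in> borel_measurable (I k)" if "0 \<le> k" for k
    by (rule w_opt_meas[OF that]) (auto simp: I_def intro: info_algebra_update)
  have e_cond: "AE \<omega> in M. cond_exp M (I k) (e_opt k) \<omega> = w_opt k \<omega> - w_kal k \<omega>" if "0 \<le> k" for k
    unfolding e_eq wk_def
    by (rule sigma_finite_subalgebra.cond_exp_diff_measurable[OF sfs w_opt_I w_opt_int w_int]) (use that in auto)
  have Sigma: "AE \<omega> in M. \<Sigma> k \<omega> = filter_cov (n k) \<omega>" if "-1 \<le> k" for k
  proof (cases "k = -1")
    case True
    then show ?thesis by (simp add: S0 n_def filter_cov_def)
  next
    case False
    with that have k: "0 \<le> k" by simp
    have [measurable]: "e_opt k \<in> borel_measurable M"
      unfolding e_eq using w_opt_int[OF k] by simp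
    have [measurable]: "cond_exp M (I k) (e_opt k) \<in> borel_measurable M"
      by (rule measurable_from_subalg[OF I_sub measurable_cond_exp])
    have "AE \<omega> in M. outer (e_opt k \<omega> - cond_exp M (I k) (e_opt k) \<omega>) (e_opt k \<omega> - cond_exp M (I k) (e_opt k) \<omega>)
        = outer (filter_err (n k) \<omega>) (filter_err (n k) \<omega>)"
      using e_cond[OF k] kal[of k]
    proof eventually_elim
      case (elim \<omega>)
      \<comment> \<open>\<open>w_opt\<close> cancels, and the sign is opposite because
        \<open>e_opt\<close> is estimate minus weight while \<open>filter_err\<close> is weight
        minus estimate; \<open>outer\<close> does not see it.\<close>
      then have "e_opt k \<omega> - cond_exp M (I k) (e_opt k) \<omega> = - filter_err (n k) \<omega>"
        by (simp add: e_def filter_err_def)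
      then show ?case by (simp add: outer_def)
    qed
    then have "AE \<omega> in M. cond_exp M (I k) (\<lambda>\<omega>. outer (e_opt k \<omega> - cond_exp M (I k) (e_opt k) \<omega>)
          (e_opt k \<omega> - cond_exp M (I k) (e_opt k) \<omega>)) \<omega>
        = cond_exp M (I k) (\<lambda>\<omega>. outer (filter_err (n k) \<omega>) (filter_err (n k) \<omega>)) \<omega>"
      by (rule sigma_finite_subalgebra.cond_exp_cong[OF sfs]) measurable
    with cov[of k] show ?thesis
      unfolding S_def[OF k] cond_cov_def I_til by eventually_elim simp
  qed
  have n_Suc: "n (k + 1) = Suc (n k)" "int (n k) = k + 1" if "-1 \<le> k" for k
    using that by (simp_all add: n_def nat_add_distrib[symmetric])
  have kal_init: "AE \<omega> in M. w_kal (-1) \<omega> = 0"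
    using kal[of "-1"] by (simp add: n_def filter_mean_def)
  have opt: "AE \<omega> in M. w_opt (k + 1) \<omega> = w_opt k \<omega> + L k *v (w_opt k \<omega> - w_kal k \<omega>)"
    if k: "-1 \<le> k" "k \<le> N - 1" for k
  proof (cases "k = -1")
    case True
    \<comment> \<open>Both estimates vanish at time \<open>-1\<close> and \<open>w_opt\<close>
      vanishes at time \<open>0\<close>, so the gain acts on the zero vector.\<close>
    show ?thesis using kal_init unfolding True by eventually_elim (simp add: w0)
  next
    case False
    with k have k0: "0 \<le> k" by simp
    show ?thesis
      using u_opt[OF k0 k(2)] e_cond[OF k0] by eventually_elim (simp add: w_step k0 I_til)
  qed
  have kal_step: "AE \<omega> in M. w_kal (k + 1) \<omega> =
      w_kal k \<omega> + H (k + 1) \<omega> *v (vec (y (k + 1) \<omega>) - C (k + 1) \<omega> *v w_kal k \<omega>)" if k: "-1 \<le> k" for k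
  proof -
    \<comment> \<open>\<open>H (k + 1)\<close> is built from the updated covariance, so
      \<open>Sigma\<close> is taken at \<open>k + 1\<close>.\<close>
    have "-1 \<le> k + 1" using k by simp
    from kal[of k] kal[of "k + 1"] Sigma[OF this] show ?thesis
    proof eventually_elim
      case (elim \<omega>)
      then show ?case
        using filter_mean_Suc[of "n k" \<omega>] by (simp add: H_def C_def n_Suc[OF k] Y)
    qed
  qed
  have cov_step: "AE \<omega> in M. \<Sigma> k \<omega> = \<Sigma> (k - 1) \<omega> - \<Sigma> (k - 1) \<omega> ** transpose (C k \<omega>)
      ** matrix_inv (C k \<omega> ** \<Sigma> (k - 1) \<omega> ** transpose (C k \<omega>) + mat (\<sigma>\<^sup>2)) ** C k \<omega> ** \<Sigma> (k - 1) \<omega>"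
    if k: "0 \<le> k" for k
  proof -
    have k': "-1 \<le> k - 1" "-1 \<le> k" using k by simp_all
    from Sigma[OF k'(1)] Sigma[OF k'(2)] show ?thesis
    proof eventually_elim
      case (elim \<omega>)
      then show ?case
        using filter_cov_Suc[of "n (k - 1)" \<omega>] n_Suc[OF k'(1)] by (simp add: C_def)
    qed
  qed
  have "AE \<omega> in M.
      w_opt (k + 1) \<omega> = w_opt k \<omega> + L k *v (w_opt k \<omega> - cond_exp M (I k) w \<omega>) \<and>
      w_opt (k + 1) \<omega> = w_opt k \<omega> + L k *v (w_opt k \<omega> - w_kal k \<omega>) \<and>
      w_opt (k + 1) \<omega> = w_opt k \<omega> + L k *v (e_opt k \<omega> - e_kal k \<omega>)"
    if "-1 \<le> k" "k \<le> N - 1" for k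
    using opt[OF that] by eventually_elim (simp add: wk_def e_def ek_def)
  with kal_init kal_step cov_step show ?thesis by blast
qed

end
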